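(* Let $\rho\in(0,2]$, $\nu\in[0,1]$, $\alpha=\sqrt{8\rho^{-1}-4}$, $\beta=2\rho^{-1}-2$, and let $X\in\mathbb{B}(\mathcal{H})$ and $\lambda\in\mathbb{C}\setminus\{0\}$. Then $$\Delta_{(\rho,\nu)}(X)^2\leq(1-2\nu)^2w_\rho(X)^2+2\left|\frac{(1-2\nu)\beta}{\lambda}\right|w_\rho(X^2)+\frac{2|1-2\nu|\max\{1,|\lambda-1|\}+|\lambda|}{2|\lambda|}\left\|\begin{bmatrix}\mathbf{A}&\mathbf{B}\\ \mathbf{B}&\mathbf{C}\end{bmatrix}\right\|,$$ where $\mathbf{A}=\alpha^2|X^*|^2$, $\mathbf{B}=\alpha\beta|X^*|^2$ and $\mathbf{C}=(\alpha^2+\beta^2)|X|^2+\beta^2|X^*|^2$.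
   Context: $\mathbb{B}(\mathcal{H})$ is the $C^*$-algebra of bounded linear operators on a complex Hilbert space $\mathcal{H}$, $\|\cdot\|$ is the operator norm, and $|A|=(A^*A)^{1/2}$. For a bounded operator $A$ on a complex Hilbert space, $w(A)=\sup_{\|z\|=1}|\langle Az,z\rangle|$ is the numerical radius. For $\rho>0$, an operator $X\in\mathbb{B}(\mathcal{H})$ is called a $\rho$-contraction if there is a Hilbert space $\mathcal{K}\supseteq\mathcal{H}$ and a unitary operator $U$ on $\mathcal{K}$ such that $X^nx=\rho PU^nx$ for all $x\in\mathcal{H}$ and $n=1,2,\dots$, where $P$ is the orthogonal projection from $\mathcal{K}$ to $\mathcal{H}$; the $\rho$-operator radius is $w_\rho(X)=\inf\{t>0: t^{-1}X\text{ is a }\rho\text{-contraction}\}$. For $\rho\in(0,2]$, $\nu\in[0,1]$, $\alpha=\sqrt{8\rho^{-1}-4}$, $\beta=2\rho^{-1}-2$ and $X\in\mathbb{B}(\mathcal{H})$ define $$\Delta_{(\rho,\nu)}(X)=w\left(\begin{bmatrix}0&\alpha X\\ \alpha(1-2\nu)X^*&\beta\left(X+(1-2\nu)X^*\right)\end{bmatrix}\right).$$ All $2\times2$ operator matrices act on $\mathcal{H}\oplus\mathcal{H}$. *)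

theory Defs
  imports "HOL-Analysis.Analysis"
begin

section \<open>Complex Hilbert spaces\<close>

text \<open>
  A complex Hilbert space is a complete real inner product space together with a compatible complex
  structure, so that norm and topology are those of the library.  The complex inner product is
  linear in its first argument; its real part is the underlying real inner product.
\<close>

class complex_inner = real_inner +
  fixes scaleC :: "complex \<Rightarrow> 'a \<Rightarrow> 'a" (infixr "*\<^sub>C" 75)
    and cinner :: "'a \<Rightarrow> 'a \<Rightarrow> complex"
  assumes scaleC_add_right: "c *\<^sub>C (x + y) = c *\<^sub>C x + c *\<^sub>C y"
    and scaleC_add_left: "(c + d) *\<^sub>C x = c *\<^sub>C x + d *\<^sub>C x"
    and scaleC_scaleC: "c *\<^sub>C d *\<^sub>C x = (c * d) *\<^sub>C x"
    and scaleC_of_real: "complex_of_real r *\<^sub>C x = r *\<^sub>R x"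
    and cinner_commute: "cinner x y = cnj (cinner y x)"
    and cinner_add_left: "cinner (x + y) z = cinner x z + cinner y z"
    and cinner_scaleC_left: "cinner (c *\<^sub>C x) y = c * cinner x y"
    and inner_eq_Re_cinner: "inner x y = Re (cinner x y)"

class complex_hilbert_space = complex_inner + complete_space

instantiation complex :: complex_hilbert_space
begin

definition scaleC_complex :: "complex \<Rightarrow> complex \<Rightarrow> complex" where
  "scaleC_complex c x = c * x"

definition cinner_complex :: "complex \<Rightarrow> complex \<Rightarrow> complex" where
  "cinner_complex x y = x * cnj y"

instance
  by standard (auto simp: scaleC_complex_def cinner_complex_def algebra_simps inner_complex_def
      scaleR_conv_of_real)

end

text \<open>The type \<^typ>\<open>'a \<times> 'a\<close> is the orthogonal direct sum of \<open>'a\<close> with itself.\<close>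

instantiation prod :: (complex_inner, complex_inner) complex_inner
begin

definition scaleC_prod :: "complex \<Rightarrow> 'a \<times> 'b \<Rightarrow> 'a \<times> 'b" where
  "scaleC_prod c z = (c *\<^sub>C fst z, c *\<^sub>C snd z)"

definition cinner_prod :: "'a \<times> 'b \<Rightarrow> 'a \<times> 'b \<Rightarrow> complex" where
  "cinner_prod z w = cinner (fst z) (fst w) + cinner (snd z) (snd w)"

instance
proof
  fix x y z :: "'a \<times> 'b" and c d :: complex and r :: real
  show "cinner x y = cnj (cinner y x)"
    unfolding cinner_prod_def
    by (metis cinner_commute complex_cnj_add)
qed (auto simp: scaleC_prod_def cinner_prod_def scaleC_add_right scaleC_add_left scaleC_scaleC
      scaleC_of_real cinner_add_left cinner_scaleC_left inner_eq_Re_cinner inner_prod_def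
      scaleR_prod_def algebra_simps)

end

instance prod :: (complex_hilbert_space, complex_hilbert_space) complex_hilbert_space ..


section \<open>Bounded operators\<close>

definition bounded_clinear :: "('a::complex_inner \<Rightarrow> 'b::complex_inner) \<Rightarrow> bool" where
  "bounded_clinear A \<longleftrightarrow> bounded_linear A \<and> (\<forall>c x. A (c *\<^sub>C x) = c *\<^sub>C A x)"

definition cadjoint :: "('a::complex_inner \<Rightarrow> 'b::complex_inner) \<Rightarrow> 'b \<Rightarrow> 'a" where
  "cadjoint A = (THE B. \<forall>x y. cinner (A x) y = cinner x (B y))"

definition positive_op :: "('a::complex_inner \<Rightarrow> 'a) \<Rightarrow> bool" where
  "positive_op A \<longleftrightarrow> bounded_clinear A \<and> (\<forall>x. cinner (A x) x \<in> \<real>\<^sub>\<ge>\<^sub>0)"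

definition abs_op :: "('a::complex_inner \<Rightarrow> 'a) \<Rightarrow> 'a \<Rightarrow> 'a" where
  "abs_op A = (THE B. positive_op B \<and> B ^^ 2 = cadjoint A \<circ> A)"

text \<open>
  The supremum is taken in \<open>[0,\<infinity>)\<close>; the inserted \<open>0\<close> only matters for the zero space, which has no
  unit vectors.
\<close>

definition numerical_radius :: "('a::complex_inner \<Rightarrow> 'a) \<Rightarrow> real" where
  "numerical_radius A = Sup (insert 0 {cmod (cinner (A z) z) | z. norm z = 1})"

definition op_matrix ::
  "('a \<Rightarrow> 'a) \<Rightarrow> ('a \<Rightarrow> 'a) \<Rightarrow> ('a \<Rightarrow> 'a) \<Rightarrow> ('a \<Rightarrow> 'a) \<Rightarrow> 'a \<times> 'a \<Rightarrow> 'a::plus \<times> 'a" where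
  "op_matrix A B C D = (\<lambda>(x, y). (A x + B y, C x + D y))"


section \<open>Unitary dilations\<close>

text \<open>
  The dilation space of a \<open>\<rho>\<close>-contraction is existentially quantified, so it has to be a value
  rather than a type: a Hilbert space is given here by a carrier set with its operations.
\<close>

record 'k hilbert =
  pts :: "'k set"
  vadd :: "'k \<Rightarrow> 'k \<Rightarrow> 'k"
  vzero :: 'k
  vscale :: "complex \<Rightarrow> 'k \<Rightarrow> 'k"
  vip :: "'k \<Rightarrow> 'k \<Rightarrow> complex"

definition vdist :: "'k hilbert \<Rightarrow> 'k \<Rightarrow> 'k \<Rightarrow> real" where
  "vdist K x y = (let d = vadd K x (vscale K (-1) y) in sqrt (Re (vip K d d)))"

locale hilbert =
  fixes K :: "'k hilbert"
  assumes zero_closed: "vzero K \<in> pts K"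
    and add_closed: "\<lbrakk>x \<in> pts K; y \<in> pts K\<rbrakk> \<Longrightarrow> vadd K x y \<in> pts K"
    and scale_closed: "x \<in> pts K \<Longrightarrow> vscale K c x \<in> pts K"
    and add_assoc: "\<lbrakk>x \<in> pts K; y \<in> pts K; z \<in> pts K\<rbrakk> \<Longrightarrow>
          vadd K (vadd K x y) z = vadd K x (vadd K y z)"
    and add_commute: "\<lbrakk>x \<in> pts K; y \<in> pts K\<rbrakk> \<Longrightarrow> vadd K x y = vadd K y x"
    and add_zero: "x \<in> pts K \<Longrightarrow> vadd K x (vzero K) = x"
    and add_neg: "x \<in> pts K \<Longrightarrow> vadd K x (vscale K (-1) x) = vzero K"
    and scale_add_right: "\<lbrakk>x \<in> pts K; y \<in> pts K\<rbrakk> \<Longrightarrow>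
          vscale K c (vadd K x y) = vadd K (vscale K c x) (vscale K c y)"
    and scale_add_left: "x \<in> pts K \<Longrightarrow>
          vscale K (c + d) x = vadd K (vscale K c x) (vscale K d x)"
    and scale_scale: "x \<in> pts K \<Longrightarrow> vscale K c (vscale K d x) = vscale K (c * d) x"
    and scale_one: "x \<in> pts K \<Longrightarrow> vscale K 1 x = x"
    and ip_commute: "\<lbrakk>x \<in> pts K; y \<in> pts K\<rbrakk> \<Longrightarrow> vip K x y = cnj (vip K y x)"
    and ip_add_left: "\<lbrakk>x \<in> pts K; y \<in> pts K; z \<in> pts K\<rbrakk> \<Longrightarrow>
          vip K (vadd K x y) z = vip K x z + vip K y z"
    and ip_scale_left: "\<lbrakk>x \<in> pts K; y \<in> pts K\<rbrakk> \<Longrightarrow> vip K (vscale K c x) y = c * vip K x y"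
    and ip_nonneg: "x \<in> pts K \<Longrightarrow> 0 \<le> Re (vip K x x)"
    and ip_eq_zero: "\<lbrakk>x \<in> pts K; vip K x x = 0\<rbrakk> \<Longrightarrow> x = vzero K"
    and complete: "\<lbrakk>\<And>n. s n \<in> pts K; \<forall>e>0. \<exists>N. \<forall>m\<ge>N. \<forall>n\<ge>N. vdist K (s m) (s n) < e\<rbrakk> \<Longrightarrow>
          \<exists>l\<in>pts K. (\<lambda>n. vdist K (s n) l) \<longlonglongrightarrow> 0"

text \<open>The inclusion of \<open>'a\<close> into \<open>K\<close> is a linear isometric embedding \<open>V\<close>.\<close>

definition isometric_embedding :: "'k hilbert \<Rightarrow> ('a::complex_inner \<Rightarrow> 'k) \<Rightarrow> bool" where
  "isometric_embedding K V \<longleftrightarrow>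
     (\<forall>x. V x \<in> pts K) \<and> (\<forall>x y. V (x + y) = vadd K (V x) (V y)) \<and>
     (\<forall>c x. V (c *\<^sub>C x) = vscale K c (V x)) \<and> (\<forall>x y. vip K (V x) (V y) = cinner x y)"

definition unitary_on :: "'k hilbert \<Rightarrow> ('k \<Rightarrow> 'k) \<Rightarrow> bool" where
  "unitary_on K U \<longleftrightarrow>
     U ` pts K = pts K \<and>
     (\<forall>x\<in>pts K. \<forall>y\<in>pts K. U (vadd K x y) = vadd K (U x) (U y)) \<and>
     (\<forall>c. \<forall>x\<in>pts K. U (vscale K c x) = vscale K c (U x)) \<and>
     (\<forall>x\<in>pts K. \<forall>y\<in>pts K. vip K (U x) (U y) = vip K x y)"

definition orth_projection :: "'k hilbert \<Rightarrow> 'k set \<Rightarrow> ('k \<Rightarrow> 'k) \<Rightarrow> bool" where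
  "orth_projection K S P \<longleftrightarrow>
     (\<forall>k\<in>pts K. P k \<in> S \<and> (\<forall>h\<in>S. vip K (vadd K k (vscale K (-1) (P k))) h = 0))"

definition rho_dilation ::
  "real \<Rightarrow> ('a::complex_hilbert_space \<Rightarrow> 'a) \<Rightarrow> 'k hilbert \<Rightarrow> ('a \<Rightarrow> 'k) \<Rightarrow> ('k \<Rightarrow> 'k) \<Rightarrow> bool" where
  "rho_dilation \<rho> X K V U \<longleftrightarrow>
     hilbert K \<and> isometric_embedding K V \<and> unitary_on K U \<and>
     (\<exists>P. orth_projection K (range V) P \<and>
       (\<forall>n\<ge>1. \<forall>x. V ((X ^^ n) x) = vscale K (complex_of_real \<rho>) (P ((U ^^ n) (V x)))))"

text \<open>
  HOL cannot quantify existentially over the type of the points of \<open>K\<close>.  The type used here is large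
  enough: a vector in a minimal dilation space is determined by its inner products with the vectors
  \<open>U\<^sup>n x\<close>, where \<open>n\<close> is an integer and \<open>x\<close> ranges over \<open>'a\<close>.  Lemma \<open>rho_contractionI\<close> below shows
  that dilations with points of any other type give the same notion.
\<close>

definition rho_contraction :: "real \<Rightarrow> ('a::complex_hilbert_space \<Rightarrow> 'a) \<Rightarrow> bool" where
  "rho_contraction \<rho> X \<longleftrightarrow>
     bounded_clinear X \<and> (\<exists>(K :: (int \<Rightarrow> 'a \<Rightarrow> complex) hilbert) V U. rho_dilation \<rho> X K V U)"

definition rho_radius :: "real \<Rightarrow> ('a::complex_hilbert_space \<Rightarrow> 'a) \<Rightarrow> real" where
  "rho_radius \<rho> X = Inf {t. 0 < t \<and> rho_contraction \<rho> (\<lambda>x. inverse t *\<^sub>R X x)}"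

definition Delta :: "real \<Rightarrow> real \<Rightarrow> ('a::complex_hilbert_space \<Rightarrow> 'a) \<Rightarrow> real" where
  "Delta \<rho> \<nu> X =
     (let \<alpha> = sqrt (8 * inverse \<rho> - 4); \<beta> = 2 * inverse \<rho> - 2 in
      numerical_radius
        (op_matrix
          (\<lambda>x. 0) (\<lambda>x. \<alpha> *\<^sub>R X x)
          (\<lambda>x. (\<alpha> * (1 - 2 * \<nu>)) *\<^sub>R cadjoint X x)
          (\<lambda>x. \<beta> *\<^sub>R (X x + (1 - 2 * \<nu>) *\<^sub>R cadjoint X x))))"


section \<open>Independence of the type of the dilation space\<close>

context hilbert
begin

lemma ip_add_right: "\<lbrakk>x \<in> pts K; y \<in> pts K; z \<in> pts K\<rbrakk> \<Longrightarrow>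
    vip K x (vadd K y z) = vip K x y + vip K x z"
  by (metis add_closed complex_cnj_add ip_add_left ip_commute)

lemma ip_scale_right: "\<lbrakk>x \<in> pts K; y \<in> pts K\<rbrakk> \<Longrightarrow> vip K x (vscale K c y) = cnj c * vip K x y"
  by (metis complex_cnj_mult ip_commute ip_scale_left scale_closed)

lemma ip_self_real: "x \<in> pts K \<Longrightarrow> vip K x x = complex_of_real (Re (vip K x x))"
  by (metis Reals_cnj_iff ip_commute of_real_Re)

lemma Cauchy_Schwarz:
  assumes x: "x \<in> pts K" and y: "y \<in> pts K"
  shows "cmod (vip K x y) \<le> sqrt (Re (vip K x x)) * sqrt (Re (vip K y y))"
proof (cases "vip K y y = 0")
  case True
  have z0: "vscale K 0 y = vzero K"
    by (metis add.right_inverse add_neg scale_add_left scale_one y)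
  have "vip K x y = vip K x (vscale K 0 y)"
    using True ip_eq_zero[OF y] z0 by simp
  then show ?thesis using x y True by (simp add: ip_scale_right)
next
  case False
  define a where "a = Re (vip K y y)"
  define b where "b = vip K x y"
  define z where "z = vadd K (vscale K a x) (vscale K (- b) y)"
  have a: "vip K y y = of_real a" using ip_self_real[OF y] by (simp add: a_def)
  with False ip_nonneg[OF y] have a0: "a > 0" by (auto simp: less_le)
  have zK: "z \<in> pts K" unfolding z_def using x y by (simp add: add_closed scale_closed)
  have byx: "vip K y x = cnj b" unfolding b_def using x y by (metis ip_commute)
  have "vip K z z = of_real a * (of_real a * vip K x x - b * cnj b)"
    unfolding z_def using x y
    by (simp add: ip_add_left ip_add_right ip_scale_left ip_scale_right add_closed scale_closed
        a byx algebra_simps flip: b_def)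
  also have "\<dots> = of_real (a * (a * Re (vip K x x) - (cmod b)^2))"
    by (subst ip_self_real[OF x]) (simp flip: complex_norm_square)
  finally have "0 \<le> a * (a * Re (vip K x x) - (cmod b)^2)"
    using ip_nonneg[OF zK] by simp
  then have "(cmod b)^2 \<le> a * Re (vip K x x)"
    using a0 by (simp add: zero_le_mult_iff)
  then have "cmod b \<le> sqrt (a * Re (vip K x x))"
    by (simp add: real_le_rsqrt)
  then show ?thesis
    by (simp add: b_def a_def real_sqrt_mult mult.commute)
qed

text \<open>The structure of a closed subspace \<open>S\<close> is carried over to another type by an injection.\<close>

lemma transport:
  fixes \<phi> :: "'k \<Rightarrow> 'l" and \<psi> :: "'l \<Rightarrow> 'k"
  assumes S: "S \<subseteq> pts K" and \<psi>: "\<And>x. x \<in> S \<Longrightarrow> \<psi> (\<phi> x) = x"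
    and S0: "vzero K \<in> S"
    and Sadd: "\<And>x y. x \<in> S \<Longrightarrow> y \<in> S \<Longrightarrow> vadd K x y \<in> S"
    and Sscale: "\<And>c x. x \<in> S \<Longrightarrow> vscale K c x \<in> S"
    and Sclosed: "\<And>s l. (\<And>n. s n \<in> S) \<Longrightarrow> l \<in> pts K \<Longrightarrow> (\<lambda>n. vdist K (s n) l) \<longlonglongrightarrow> 0 \<Longrightarrow> l \<in> S"
  shows "hilbert \<lparr>pts = \<phi> ` S, vadd = \<lambda>f g. \<phi> (vadd K (\<psi> f) (\<psi> g)), vzero = \<phi> (vzero K),
           vscale = \<lambda>c f. \<phi> (vscale K c (\<psi> f)), vip = \<lambda>f g. vip K (\<psi> f) (\<psi> g)\<rparr>"
    (is "hilbert ?L")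
proof -
  have SK: "x \<in> pts K" if "x \<in> S" for x using that S by blast
  have dist: "vdist ?L (\<phi> x) (\<phi> y) = vdist K x y" if "x \<in> S" "y \<in> S" for x y
    using that by (simp add: vdist_def Let_def \<psi> Sadd Sscale)
  show ?thesis
  proof (rule hilbert.intro, goal_cases)
    case (17 s)
    define t where "t n = \<psi> (s n)" for n
    have t: "t n \<in> S" "s n = \<phi> (t n)" for n
      using 17(1)[of n] by (auto simp: t_def \<psi>)
    have "\<exists>l\<in>pts K. (\<lambda>n. vdist K (t n) l) \<longlonglongrightarrow> 0"
      using 17(2) by (intro complete) (auto simp: t SK dist)
    then obtain l where l: "l \<in> pts K" "(\<lambda>n. vdist K (t n) l) \<longlonglongrightarrow> 0" by blast
    with t have "l \<in> S" by (intro Sclosed[of t l]) auto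
    with l show ?case by (auto simp: t dist intro!: bexI[of _ "\<phi> l"])
  qed (auto simp: \<psi> S0 Sadd Sscale SK add_assoc add_zero add_neg scale_add_right scale_add_left
      scale_scale scale_one ip_add_left ip_scale_left ip_nonneg intro: ip_commute ip_eq_zero
      arg_cong[where f = \<phi>, OF add_commute] arg_cong[where f = \<phi>, OF ip_eq_zero])
qed

end

lemma rho_contractionI:
  fixes K :: "'k hilbert" and X :: "'a::complex_hilbert_space \<Rightarrow> 'a"
  assumes X: "bounded_clinear X" and dil: "rho_dilation \<rho> X K V U"
  shows "rho_contraction \<rho> X"
proof -
  interpret hilbert K using dil by (simp add: rho_dilation_def)
  obtain P where P: "orth_projection K (range V) P"
    and pow: "\<And>n x. n \<ge> 1 \<Longrightarrow> V ((X ^^ n) x) = vscale K (complex_of_real \<rho>) (P ((U ^^ n) (V x)))"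
    using dil by (auto simp: rho_dilation_def)
  have V: "V x \<in> pts K" "V (x + y) = vadd K (V x) (V y)" "V (c *\<^sub>C x) = vscale K c (V x)"
    "vip K (V x) (V y) = cinner x y" for x y c
    using dil by (auto simp: rho_dilation_def isometric_embedding_def)
  have un: "unitary_on K U" using dil by (auto simp: rho_dilation_def)
  have Ucl: "U x \<in> pts K" if "x \<in> pts K" for x
    using un that by (auto simp: unitary_on_def)
  have Uadd: "U (vadd K x y) = vadd K (U x) (U y)" if "x \<in> pts K" "y \<in> pts K" for x y
    using un that by (auto simp: unitary_on_def)
  have Uscale: "U (vscale K c x) = vscale K c (U x)" if "x \<in> pts K" for c x
    using un that by (auto simp: unitary_on_def)
  have Uip: "vip K (U x) (U y) = vip K x y" if "x \<in> pts K" "y \<in> pts K" for x y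
    using un that by (auto simp: unitary_on_def)
  have Usurj: "\<exists>y\<in>pts K. x = U y" if "x \<in> pts K" for x
    using un that unfolding unitary_on_def by blast
  have Upcl: "(U ^^ n) x \<in> pts K" if "x \<in> pts K" for n x
    using that by (induction n) (auto simp: Ucl)
  have Upadd: "(U ^^ n) (vadd K x y) = vadd K ((U ^^ n) x) ((U ^^ n) y)"
    if "x \<in> pts K" "y \<in> pts K" for n x y
    using that by (induction n) (auto simp: Uadd Upcl)
  have Upscale: "(U ^^ n) (vscale K c x) = vscale K c ((U ^^ n) x)" if "x \<in> pts K" for n c x
    using that by (induction n) (auto simp: Uscale Upcl)

  define \<phi> :: "'k \<Rightarrow> int \<Rightarrow> 'a \<Rightarrow> complex" where
    "\<phi> k n x = vip K ((U ^^ nat n) k) ((U ^^ nat (- n)) (V x))" for k n x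
  have \<phi>_U: "\<phi> (U k) n x = \<phi> k (n + 1) x" if "k \<in> pts K" for k n x
  proof (cases "n \<ge> 0")
    case True
    then have "nat (n + 1) = Suc (nat n)" by simp
    with True show ?thesis by (simp add: \<phi>_def funpow_swap1)
  next
    case False
    then have "nat (- n) = Suc (nat (- (n + 1)))" "nat n = 0" "nat (n + 1) = 0" by auto
    with that show ?thesis by (simp add: \<phi>_def Uip Upcl V)
  qed
  have \<phi>_add: "\<phi> (vadd K k l) n x = \<phi> k n x + \<phi> l n x" if "k \<in> pts K" "l \<in> pts K" for k l n x
    using that by (simp add: \<phi>_def Upadd Upcl V ip_add_left)
  have \<phi>_scale: "\<phi> (vscale K c k) n x = c * \<phi> k n x" if "k \<in> pts K" for k c n x
    using that by (simp add: \<phi>_def Upscale Upcl V ip_scale_left)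

  define N where "N = {y \<in> pts K. \<forall>n x. \<phi> y n x = 0}"
  define S where "S = {k \<in> pts K. \<forall>y\<in>N. vip K k y = 0}"
  have SK: "S \<subseteq> pts K" and NK: "N \<subseteq> pts K" by (auto simp: S_def N_def)
  have SKI: "x \<in> S \<Longrightarrow> x \<in> pts K" for x using SK by blast
  have NU: "U y \<in> N \<longleftrightarrow> y \<in> N" if "y \<in> pts K" for y
  proof
    assume "U y \<in> N"
    then have "\<phi> y (n + 1) x = 0" for n x
      using that by (simp add: N_def flip: \<phi>_U)
    from this[of "n - 1" for n] show "y \<in> N" using that by (simp add: N_def)
  qed (use that in \<open>auto simp: N_def \<phi>_U Ucl\<close>)
  have SU: "U k \<in> S" if "k \<in> S" for k
  proof -
    have "vip K (U k) y = 0" if y: "y \<in> N" for y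
    proof -
      obtain y' where y': "y' \<in> pts K" "y = U y'" using y NK Usurj by blast
      then have "y' \<in> N" using y NU by simp
      then show ?thesis using y' \<open>k \<in> S\<close> by (simp add: S_def Uip)
    qed
    then show ?thesis using that by (simp add: S_def Ucl)
  qed
  have SU': "\<exists>l\<in>S. k = U l" if k: "k \<in> S" for k
  proof -
    obtain l where l: "l \<in> pts K" "k = U l" using k SK Usurj by blast
    have "vip K l y = 0" if y: "y \<in> N" for y
    proof -
      have "U y \<in> N" using y NU NK by blast
      then have "vip K (U l) (U y) = 0" using k l by (simp add: S_def)
      then show ?thesis using l y NK by (simp add: Uip subset_iff)
    qed
    with l show ?thesis by (auto simp: S_def)
  qed
  have SV: "V x \<in> S" for x
  proof -
    have "vip K (V x) y = 0" if y: "y \<in> N" for y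
    proof -
      have "\<phi> y 0 x = 0" using y by (simp add: N_def)
      then have "vip K y (V x) = 0" by (simp add: \<phi>_def)
      then show ?thesis using y NK V by (metis complex_cnj_zero ip_commute subsetD)
    qed
    then show ?thesis by (simp add: S_def V)
  qed
  have Sadd: "vadd K x y \<in> S" if "x \<in> S" "y \<in> S" for x y
    using that NK by (auto simp: S_def add_closed ip_add_left subset_iff)
  have Sscale: "vscale K c x \<in> S" if "x \<in> S" for c x
    using that NK by (auto simp: S_def scale_closed ip_scale_left subset_iff)
  have S0: "vzero K \<in> S"
    using Sadd[OF SV Sscale[OF SV], of 0 "-1" 0] by (simp add: add_neg V)
  have Sclosed: "l \<in> S" if s: "\<And>n. s n \<in> S" and l: "l \<in> pts K"
    and lim: "(\<lambda>n. vdist K (s n) l) \<longlonglongrightarrow> 0" for s l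
  proof -
    have "vip K l y = 0" if y: "y \<in> N" for y
    proof -
      have yK: "y \<in> pts K" using y NK by blast
      have sK: "s n \<in> pts K" for n using s SK by blast
      have bd: "cmod (vip K l y) \<le> vdist K (s n) l * sqrt (Re (vip K y y))" for n
      proof -
        define d where "d = vadd K (s n) (vscale K (-1) l)"
        have dK: "d \<in> pts K" using sK l by (simp add: d_def add_closed scale_closed)
        have "vip K d y = - vip K l y"
          using sK l yK s[of n] y
          by (simp add: d_def ip_add_left scale_closed ip_scale_left S_def)
        then have "cmod (vip K l y) = cmod (vip K d y)" by simp
        also have "\<dots> \<le> vdist K (s n) l * sqrt (Re (vip K y y))"
          using Cauchy_Schwarz[OF dK yK] by (simp add: vdist_def d_def Let_def)
        finally show ?thesis .
      qed
      have "(\<lambda>n. vdist K (s n) l * sqrt (Re (vip K y y))) \<longlonglongrightarrow> 0 * sqrt (Re (vip K y y))"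
        by (intro tendsto_intros lim)
      then have "cmod (vip K l y) \<le> 0 * sqrt (Re (vip K y y))"
        by (rule LIMSEQ_le_const) (use bd in auto)
      then show ?thesis by simp
    qed
    with l show ?thesis by (simp add: S_def)
  qed
  have inj: "inj_on \<phi> S"
  proof (rule inj_onI)
    fix k l assume k: "k \<in> S" and l: "l \<in> S" and eq: "\<phi> k = \<phi> l"
    define d where "d = vadd K k (vscale K (-1) l)"
    have kK: "k \<in> pts K" and lK: "l \<in> pts K" using k l SK by auto
    have dS: "d \<in> S" using k l by (simp add: d_def Sadd Sscale)
    have "d \<in> N" using eq kK lK by (simp add: N_def d_def add_closed scale_closed \<phi>_add \<phi>_scale)
    then have "vip K d d = 0" using dS by (simp add: S_def)
    then have d0: "d = vzero K" using dS SK ip_eq_zero by blast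
    have "k = vadd K k (vadd K l (vscale K (-1) l))"
      using kK lK by (simp add: add_neg add_zero)
    also have "\<dots> = vadd K d l"
      unfolding d_def using kK lK
      by (metis add_assoc add_commute scale_closed)
    also have "\<dots> = l" using d0 lK by (metis add_commute add_zero zero_closed)
    finally show "k = l" .
  qed
  define \<psi> where "\<psi> = inv_into S \<phi>"
  have \<psi>: "\<psi> (\<phi> x) = x" if "x \<in> S" for x
    using that inj by (simp add: \<psi>_def)
  define L :: "(int \<Rightarrow> 'a \<Rightarrow> complex) hilbert" where
    "L = \<lparr>pts = \<phi> ` S, vadd = \<lambda>f g. \<phi> (vadd K (\<psi> f) (\<psi> g)), vzero = \<phi> (vzero K),
       vscale = \<lambda>c f. \<phi> (vscale K c (\<psi> f)), vip = \<lambda>f g. vip K (\<psi> f) (\<psi> g)\<rparr>"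
  define V' where "V' x = \<phi> (V x)" for x
  define U' where "U' f = \<phi> (U (\<psi> f))" for f
  define P' where "P' f = \<phi> (P (\<psi> f))" for f
  have "hilbert L"
    unfolding L_def by (rule transport) (fact SK \<psi> S0 Sadd Sscale Sclosed)+
  moreover have "isometric_embedding L V'"
    by (auto simp: isometric_embedding_def L_def V'_def \<psi> SV) (auto simp: V)
  moreover have "unitary_on L U'"
  proof -
    have "U' ` \<phi> ` S = \<phi> ` S"
      using SU SU' by (force simp: U'_def \<psi> image_iff)
    then show ?thesis
      by (auto simp: unitary_on_def L_def U'_def \<psi> SU Sadd Sscale Uadd Uscale Uip SKI)
  qed
  moreover have PS: "P k \<in> range V" "P k \<in> S" if "k \<in> pts K" for k
    using P that SV by (auto simp: orth_projection_def)
  have PV: "\<phi> (P k) \<in> range (\<lambda>x. \<phi> (V x))" if "k \<in> S" for k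
    using PS(1)[OF SKI[OF that]] by (auto simp: image_iff)
  have "orth_projection L (range V') P'"
    using P PS PV by (auto simp: orth_projection_def L_def V'_def P'_def \<psi> SV Sadd Sscale SKI)
  moreover have "V' ((X ^^ n) x) = vscale L (complex_of_real \<rho>) (P' ((U' ^^ n) (V' x)))"
    if n: "n \<ge> 1" for n x
  proof -
    have "(U' ^^ n) (V' x) = \<phi> ((U ^^ n) (V x)) \<and> (U ^^ n) (V x) \<in> S" for n
      by (induction n) (auto simp: V'_def U'_def \<psi> SV SU)
    then show ?thesis
      using PS pow[OF n, of x] by (simp add: L_def P'_def V'_def \<psi> SKI)
  qed
  ultimately have "rho_dilation \<rho> X L V' U'"
    unfolding rho_dilation_def by blast
  with X show ?thesis unfolding rho_contraction_def by blast
qed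

end

theory Submission
  imports Defs
begin

text \<open>
  Let \<open>T = [[0, \<alpha> X], [0, \<beta> X]]\<close> and \<open>c = 1 - 2 \<nu>\<close>, so that \<open>\<Delta>(X) = w(T + c T\<^sup>*)\<close>.  A unitary dilation of
  \<open>X\<close> makes the operators \<open>I + Re (z T)\<close> with \<open>\<bar>z\<bar> \<le> 1\<close> positive, hence \<open>w(T) \<le> w\<^sub>\<rho>(X)\<close>; likewise
  \<open>w(T\<^sup>2) \<le> \<bar>\<beta>\<bar> w\<^sub>\<rho>(X\<^sup>2)\<close>, because \<open>T\<^sup>2\<close> is \<open>\<beta>\<close> times the matrix belonging to \<open>X\<^sup>2\<close>.  The block matrix with
  entries \<open>A\<close>, \<open>B\<close>, \<open>C\<close> is \<open>T T\<^sup>* + T\<^sup>* T\<close>, and for a unit vector \<open>z\<close> the number \<open>s = \<langle>T z, z\<rangle>\<close> satisfies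
  \<open>\<bar>s + c s\<^sup>*\<bar>\<^sup>2 \<le> c\<^sup>2 \<bar>s\<bar>\<^sup>2 + 2 \<bar>c\<bar> \<bar>\<langle>T z, z\<rangle> \<langle>z, T\<^sup>* z\<rangle>\<bar> + \<bar>s\<bar>\<^sup>2\<close>.  The middle term is estimated by Buzano's
  inequality with parameter \<open>\<lambda>\<close>, the last one by \<open>\<bar>s\<bar>\<^sup>2 \<le> \<parallel>T z\<parallel> \<parallel>T\<^sup>* z\<parallel>\<close>.

  As \<open>w\<^sub>\<rho>\<close> is an infimum of reals, one also has to know that some multiple of \<open>X\<close> is a
  \<open>\<rho>\<close>-contraction; for this a dilation of operators of small norm is constructed.
\<close>

section \<open>Complex inner product spaces\<close>

lemma cinner_add_right: "cinner x (y + z) = cinner x y + cinner x (z::'a::complex_inner)"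
  by (metis cinner_add_left cinner_commute complex_cnj_add)

lemma cinner_scaleC_right: "cinner x (c *\<^sub>C y) = cnj c * cinner x (y::'a::complex_inner)"
  by (metis cinner_commute cinner_scaleC_left complex_cnj_mult)

lemma scaleR_scaleC: "r *\<^sub>R x = complex_of_real r *\<^sub>C (x::'a::complex_inner)"
  by (simp add: scaleC_of_real)

lemma cinner_scaleR_left: "cinner (r *\<^sub>R x) y = of_real r * cinner x (y::'a::complex_inner)"
  by (simp add: scaleR_scaleC cinner_scaleC_left)

lemma cinner_scaleR_right: "cinner x (r *\<^sub>R y) = of_real r * cinner x (y::'a::complex_inner)"
  by (simp add: scaleR_scaleC cinner_scaleC_right)

lemma cinner_minus_left: "cinner (- x) y = - cinner x (y::'a::complex_inner)"
  using cinner_scaleR_left[of "-1" x y] by simp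

lemma cinner_minus_right: "cinner x (- y) = - cinner x (y::'a::complex_inner)"
  using cinner_scaleR_right[of x "-1" y] by simp

lemma cinner_diff_left: "cinner (x - y) z = cinner x z - cinner y (z::'a::complex_inner)"
  using cinner_add_left[of x "- y" z] by (simp add: cinner_minus_left)

lemma cinner_diff_right: "cinner x (y - z) = cinner x y - cinner x (z::'a::complex_inner)"
  using cinner_add_right[of x y "- z"] by (simp add: cinner_minus_right)

lemma cinner_zero [simp]: "cinner 0 x = 0" "cinner x 0 = (0::complex)" for x :: "'a::complex_inner"
  using cinner_scaleR_left[of 0 x x] cinner_scaleR_right[of x 0 x] by simp_all

lemmas cinner_simps = cinner_add_left cinner_add_right cinner_diff_left cinner_diff_right
  cinner_minus_left cinner_minus_right cinner_scaleC_left cinner_scaleC_right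
  cinner_scaleR_left cinner_scaleR_right

lemma cinner_self: "cinner x x = complex_of_real ((norm x)^2)" for x :: "'a::complex_inner"
proof -
  have "Im (cinner x x) = 0" using arg_cong[OF cinner_commute[of x x], of Im] by simp
  then show ?thesis
    by (simp add: complex_eq_iff power2_norm_eq_inner inner_eq_Re_cinner)
qed

lemma norm_scaleC: "norm (c *\<^sub>C x) = cmod c * norm (x::'a::complex_inner)"
proof -
  have "complex_of_real ((norm (c *\<^sub>C x))^2) = (c * cnj c) * cinner x x"
    by (simp only: cinner_self[symmetric] cinner_simps mult_ac)
  also have "\<dots> = complex_of_real ((cmod c * norm x)^2)"
    by (simp add: cinner_self power_mult_distrib flip: complex_norm_square)
  finally have "(norm (c *\<^sub>C x))^2 = (cmod c * norm x)^2" by (simp only: of_real_eq_iff)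
  then show ?thesis by (simp add: power2_eq_iff_nonneg)
qed

text \<open>Turns a modulus into a real part, so that a bound on real parts over all unimodular
  multiples becomes a bound on the modulus.\<close>

lemma unimodular_rotation:
  obtains c where "cmod c = 1" "c * z = complex_of_real (cmod z)"
proof (cases "z = 0")
  case False
  with that[of "of_real (cmod z) / z"] show ?thesis by (simp add: norm_divide)
qed (use that[of 1] in auto)

lemma cinner_Cauchy_Schwarz: "cmod (cinner x y) \<le> norm x * norm (y::'a::complex_inner)"
proof -
  obtain c where c: "cmod c = 1" "c * cinner x y = of_real (cmod (cinner x y))"
    by (rule unimodular_rotation)
  have "cmod (cinner x y) = inner (c *\<^sub>C x) y"
    using c by (simp add: inner_eq_Re_cinner cinner_simps)
  also have "\<dots> \<le> norm (c *\<^sub>C x) * norm y" by (rule norm_cauchy_schwarz)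
  finally show ?thesis using c by (simp add: norm_scaleC)
qed

lemma cinner_ext:
  assumes "\<And>x. cinner x y = cinner x (z::'a::complex_inner)"
  shows "y = z"
proof -
  have "cinner (y - z) (y - z) = 0" by (subst cinner_diff_right) (simp add: assms)
  then show ?thesis by (simp add: cinner_self)
qed

lemma scaleC_one: "1 *\<^sub>C x = (x::'a::complex_inner)"
  using scaleC_of_real[of 1 x] by simp

lemma scaleC_zero: "0 *\<^sub>C x = 0" "c *\<^sub>C 0 = (0::'a)" for x :: "'a::complex_inner"
proof -
  have *: "0 *\<^sub>C x = 0" for x :: 'a using scaleC_of_real[of 0 x] by simp
  then show "0 *\<^sub>C x = 0" .
  show "c *\<^sub>C 0 = (0::'a)" using scaleC_scaleC[of c 0 "0::'a"] by (simp add: *)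
qed

lemma scaleC_diff_right: "c *\<^sub>C (x - y) = c *\<^sub>C x - c *\<^sub>C (y::'a::complex_inner)"
  using scaleC_add_right[of c "x - y" y] by (simp add: algebra_simps)

lemma tendsto_cinner:
  fixes f g :: "'b \<Rightarrow> 'a::complex_inner"
  assumes f: "(f \<longlongrightarrow> a) F" and g: "(g \<longlongrightarrow> b) F"
  shows "((\<lambda>x. cinner (f x) (g x)) \<longlongrightarrow> cinner a b) F"
proof -
  \<comment> \<open>The imaginary part is recovered from the real inner product by rotating the
    first argument by \<open>\<i>\<close>; rotation is an isometry and so preserves the limit of
    \<open>f\<close>.\<close>
  have *: "cinner x y = Complex (inner x y) (- inner (\<i> *\<^sub>C x) y)" for x y :: 'a
    by (simp add: complex_eq_iff inner_eq_Re_cinner cinner_simps)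
  have "norm (\<i> *\<^sub>C f x - \<i> *\<^sub>C a) = norm (f x - a)" for x
    by (metis norm_scaleC norm_ii mult_1 scaleC_add_right add_diff_cancel_right' diff_add_cancel)
  then have "((\<lambda>x. \<i> *\<^sub>C f x) \<longlongrightarrow> \<i> *\<^sub>C a) F"
    using f by (simp add: tendsto_iff dist_norm)
  then show ?thesis unfolding *
    by (intro tendsto_Complex tendsto_intros f g)
qed

section \<open>The Riesz representation theorem and adjoints\<close>

text \<open>The representing vector minimizes the functional \<open>\<parallel>x\<parallel>\<^sup>2 - 2 f x\<close>.\<close>

lemma Riesz_real:
  fixes f :: "'a::{real_inner, complete_space} \<Rightarrow> real"
  assumes f: "bounded_linear f"
  obtains h where "\<And>x. f x = inner x h"
proof -
  interpret f: bounded_linear f by fact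
  define J where "J x = (norm x)^2 - 2 * f x" for x
  obtain K where K: "\<And>x. \<bar>f x\<bar> \<le> norm x * K" using f.bounded by auto
  \<comment> \<open>Completing the square: \<open>J x\<close> is at least
    \<open>(norm x - K)^2 - K^2\<close>.\<close>
  have lower: "J x \<ge> - (K^2)" for x
    using K[of x] zero_le_power2[of "norm x - K"] by (simp add: J_def power2_eq_square algebra_simps)
  define m where "m = Inf (range J)"
  have bdd: "bdd_below (range J)" using lower by (auto simp: bdd_below_def)
  have mJ: "m \<le> J x" for x unfolding m_def using bdd by (intro cInf_lower) auto
  have "\<exists>x. J x < m + 1 / real (Suc n)" for n
    using cInf_less_iff[of "range J" "m + 1 / real (Suc n)"] bdd by (auto simp: m_def)
  then obtain s where s: "\<And>n. J (s n) < m + 1 / real (Suc n)" by metis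
  \<comment> \<open>Parallelogram law: the midpoint also has \<open>J\<close> at least
    \<open>m\<close>, so two near-minimizers are close to each other. This makes \<open>s\<close>
    Cauchy.\<close>
  have par: "(norm (x - y))^2 \<le> 2 * (J x - m) + 2 * (J y - m)" for x y
  proof -
    have "(norm (x - y))^2 = 2 * J x + 2 * J y - 4 * J ((1/2) *\<^sub>R (x + y))"
      unfolding J_def power2_norm_eq_inner f.scaleR f.add
      by (simp add: inner_simps inner_commute field_simps)
    then show ?thesis using mJ[of "(1/2) *\<^sub>R (x + y)"] by simp
  qed
  have "Cauchy s"
  proof (rule metric_CauchyI)
    fix e :: real assume e: "e > 0"
    obtain N where N: "1 / real (Suc N) < e^2 / 4"
      using e reals_Archimedean[of "e^2/4"] by (auto simp: inverse_eq_divide)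
    have small: "J (s n) - m < e^2 / 4" if "n \<ge> N" for n
    proof -
      have "1 / real (Suc n) \<le> 1 / real (Suc N)" using that by (simp add: frac_le)
      then show ?thesis using s[of n] N by linarith
    qed
    have "dist (s i) (s j) < e" if "i \<ge> N" "j \<ge> N" for i j
    proof -
      have "(norm (s i - s j))^2 < 2 * (e^2 / 4) + 2 * (e^2 / 4)"
        using par[of "s i" "s j"] small[OF that(1)] small[OF that(2)] by argo
      then have "(norm (s i - s j))^2 < e^2" by simp
      then show ?thesis using e by (simp add: dist_norm power2_less_imp_less)
    qed
    then show "\<exists>N. \<forall>i\<ge>N. \<forall>j\<ge>N. dist (s i) (s j) < e" by blast
  qed
  then obtain h where h: "s \<longlonglongrightarrow> h" by (auto simp: Cauchy_convergent_iff convergent_def)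
  have "J h \<le> m"
  proof (rule LIMSEQ_le)
    show "(\<lambda>n. J (s n)) \<longlonglongrightarrow> J h" unfolding J_def by (intro tendsto_intros h f.tendsto)
    show "(\<lambda>n. m + 1 / real (Suc n)) \<longlonglongrightarrow> m" using tendsto_add[OF tendsto_const LIMSEQ_inverse_real_of_nat, of m]
      by (simp add: inverse_eq_divide)
    show "\<exists>N. \<forall>n\<ge>N. J (s n) \<le> m + 1 / real (Suc n)" using s less_imp_le by blast
  qed
  then have min: "J h \<le> J x" for x using mJ[of x] by linarith
  have "f x = inner x h" for x
  proof (cases "x = 0")
    case False
    define d where "d = f x - inner x h"
    \<comment> \<open>The minimizer of \<open>t^2 * (norm x)^2 - 2 * t * d\<close>; a nonzero
      \<open>d\<close> would push \<open>J\<close> below its minimum.\<close>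
    define t where "t = d / (norm x)^2"
    have "J (h + t *\<^sub>R x) = J h - 2 * t * d + t^2 * (norm x)^2"
      unfolding J_def power2_norm_eq_inner f.scaleR f.add d_def
      by (simp add: inner_simps inner_commute power2_eq_square field_simps)
    also have "\<dots> = J h - d^2 / (norm x)^2"
      using False by (simp add: t_def power2_eq_square field_simps)
    finally have "d^2 / (norm x)^2 \<le> 0" using min[of "h + t *\<^sub>R x"] by simp
    then have "d = 0" using False by (simp add: divide_le_0_iff)
    then show ?thesis by (simp add: d_def)
  qed (simp add: f.zero)
  then show ?thesis using that by blast
qed

text \<open>The real case represents the real part of \<open>f\<close>; the imaginary part follows
  by complex linearity, as \<open>Im (f x) = - Re (f (\<i> *\<^sub>C x))\<close>.\<close>

lemma Riesz:
  fixes f :: "'a::complex_hilbert_space \<Rightarrow> complex"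
  assumes add: "\<And>x y. f (x + y) = f x + f y" and scale: "\<And>c x. f (c *\<^sub>C x) = c * f x"
    and bd: "\<And>x. cmod (f x) \<le> K * norm x"
  obtains h where "\<And>x. f x = cinner x h"
proof -
  have "bounded_linear (\<lambda>x. Re (f x))"
  proof (rule bounded_linear_intro[where K = K])
    show "norm (Re (f x)) \<le> norm x * K" for x
      using bd[of x] abs_Re_le_cmod[of "f x"] by (simp add: mult.commute)
  qed (auto simp: add scale scaleR_scaleC)
  then obtain h where h: "\<And>x. Re (f x) = inner x h" using Riesz_real by blast
  have "f x = cinner x h" for x
    using h[of x] h[of "\<i> *\<^sub>C x"]
    by (simp add: complex_eq_iff inner_eq_Re_cinner scale cinner_simps)
  then show ?thesis using that by blast
qed

section \<open>Bounded complex linear operators\<close>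

lemma bounded_clinearI:
  assumes "\<And>x y. A (x + y) = A x + A y" "\<And>c x. A (c *\<^sub>C x) = c *\<^sub>C A x"
    "\<And>x. norm (A x) \<le> K * norm x"
  shows "bounded_clinear A"
  unfolding bounded_clinear_def using assms
  by (auto simp: scaleR_scaleC mult.commute intro!: bounded_linear_intro[where K = K])

lemma
  assumes "bounded_clinear A"
  shows bounded_clinear_add: "A (x + y) = A x + A y"
    and bounded_clinear_diff: "A (x - y) = A x - A y"
    and bounded_clinear_scaleC: "A (c *\<^sub>C x) = c *\<^sub>C A x"
    and bounded_clinear_scaleR: "A (r *\<^sub>R x) = r *\<^sub>R A x"
    and bounded_clinear_zero: "A 0 = 0"
    and bounded_clinear_onorm: "norm (A x) \<le> onorm A * norm x"
proof -
  interpret bounded_linear A using assms by (simp add: bounded_clinear_def)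
  show "A (x + y) = A x + A y" "A (x - y) = A x - A y" "A (r *\<^sub>R x) = r *\<^sub>R A x" "A 0 = 0"
    by (simp_all add: add diff scaleR zero)
  show "norm (A x) \<le> onorm A * norm x" by (simp add: onorm bounded_linear_axioms)
qed (use assms in \<open>simp add: bounded_clinear_def\<close>)

lemma bounded_clinear_compose:
  assumes "bounded_clinear A" "bounded_clinear B"
  shows "bounded_clinear (A \<circ> B)"
  using assms bounded_linear_compose[of A B] by (simp add: bounded_clinear_def o_def)

lemma bounded_clinear_add_ops:
  assumes "bounded_clinear A" "bounded_clinear B"
  shows "bounded_clinear (\<lambda>x. A x + B x)"
  using assms bounded_linear_add[of A B] by (simp add: bounded_clinear_def scaleC_add_right)

lemma bounded_clinear_scaleR_op:
  assumes "bounded_clinear A"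
  shows "bounded_clinear (\<lambda>x. r *\<^sub>R A x)"
  using assms bounded_linear_const_scaleR[of A r]
  by (simp add: bounded_clinear_def scaleR_scaleC scaleC_scaleC mult.commute)

section \<open>Adjoints of bounded operators\<close>

lemma adjoint_unique:
  assumes "\<And>x y. cinner (A x) y = cinner x (B y)"
  shows "cadjoint A = B"
  unfolding cadjoint_def
proof (rule the_equality)
  fix D assume D: "\<forall>x y. cinner (A x) y = cinner x (D y)"
  show "D = B" by (rule ext, rule cinner_ext) (metis D assms)
qed (use assms in auto)

text \<open>Existence is Riesz applied to \<open>\<lambda>x. cinner (A x) y\<close>. For the norm
  bound, \<open>A\<close> is tested at the vector \<open>cadjoint A y\<close>, and one factor of its
  norm cancels.\<close>

lemma
  fixes A :: "'a::complex_hilbert_space \<Rightarrow> 'b::complex_inner"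
  assumes A: "bounded_clinear A"
  shows cinner_cadjoint: "cinner (A x) y = cinner x (cadjoint A y)"
    and bounded_clinear_cadjoint: "bounded_clinear (cadjoint A)"
    and norm_cadjoint_le: "0 \<le> K \<Longrightarrow> (\<And>x. norm (A x) \<le> K * norm x) \<Longrightarrow> norm (cadjoint A y) \<le> K * norm y"
proof -
  have "\<exists>h. \<forall>x. cinner (A x) y = cinner x h" for y
  proof -
    have "cmod (cinner (A x) y) \<le> (onorm A * norm y) * norm x" for x
      using cinner_Cauchy_Schwarz[of "A x" y] mult_right_mono[OF bounded_clinear_onorm[OF A, of x], of "norm y"]
      by (simp add: mult_ac)
    then show ?thesis
      using Riesz[of "\<lambda>x. cinner (A x) y" "onorm A * norm y"] A
      by (metis bounded_clinear_add bounded_clinear_scaleC cinner_add_left cinner_scaleC_left)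
  qed
  then obtain B where B: "\<And>x y. cinner (A x) y = cinner x (B y)" by metis
  have adj: "cadjoint A = B" using B by (rule adjoint_unique)
  show "cinner (A x) y = cinner x (cadjoint A y)" by (simp add: adj B)
  have bd: "norm (B y) \<le> K * norm y" if K0: "0 \<le> K" and K: "\<And>x. norm (A x) \<le> K * norm x" for y K
  proof (cases "B y = 0")
    case True
    then show ?thesis using K0 by simp
  next
    case False
    have "norm (B y) * norm (B y) = cmod (cinner (A (B y)) y)"
      by (simp add: B cinner_self power2_eq_square norm_mult)
    also have "\<dots> \<le> (K * norm (B y)) * norm y"
      using cinner_Cauchy_Schwarz[of "A (B y)" y] mult_right_mono[OF K[of "B y"], of "norm y"] by simp
    finally show ?thesis using False by (simp add: mult_ac)
  qed
  show "bounded_clinear (cadjoint A)" unfolding adj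
  proof (rule bounded_clinearI)
    show "B (x + y) = B x + B y" for x y
      by (rule cinner_ext) (simp add: cinner_simps flip: B)
    show "B (c *\<^sub>C x) = c *\<^sub>C B x" for c x
      by (rule cinner_ext) (simp add: cinner_simps flip: B)
    show "norm (B x) \<le> onorm A * norm x" for x
      using A by (intro bd bounded_clinear_onorm onorm_pos_le) (simp_all add: bounded_clinear_def)
  qed
  show "norm (cadjoint A y) \<le> K * norm y" if "0 \<le> K" "\<And>x. norm (A x) \<le> K * norm x"
    using bd[OF that] adj by simp
qed

lemma cadjoint_cadjoint:
  fixes A :: "'a::complex_hilbert_space \<Rightarrow> 'b::complex_inner"
  assumes A: "bounded_clinear A"
  shows "cadjoint (cadjoint A) = A"
proof (rule adjoint_unique)
  show "cinner (cadjoint A x) y = cinner x (A y)" for x y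
    by (metis A cinner_cadjoint cinner_commute)
qed

section \<open>Square roots of positive operators\<close>

text \<open>Polarization in coordinates: with \<open>a = cinner (B x) y\<close> and
  \<open>b = cinner (B y) x\<close>, and the form of \<open>B\<close> real at \<open>x\<close> and
  \<open>y\<close>, the assumptions say that it is real at \<open>x + y\<close> and at
  \<open>\<i> *\<^sub>C x + y\<close>.\<close>

lemma eq_cnj_of_Im_eq_zero:
  assumes "Im (a + b) = 0" "Im (\<i> * a - \<i> * b) = 0"
  shows "a = cnj b"
  using assms by (simp add: complex_eq_iff)

lemma positive_op_symmetric:
  assumes B: "positive_op B"
  shows "cinner (B x) y = cinner x (B y)"
proof -
  have lin: "bounded_clinear B" and re: "Im (cinner (B x) x) = 0" for x
    using B by (auto simp: positive_op_def complex_nonneg_Reals_iff)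
  have "Im (cinner (B x) y + cinner (B y) x) = 0"
    using re[of "x + y"] re[of x] re[of y] by (simp add: bounded_clinear_add[OF lin] cinner_simps)
  moreover have "Im (\<i> * cinner (B x) y - \<i> * cinner (B y) x) = 0"
    using re[of "\<i> *\<^sub>C x + y"] re[of x] re[of y]
    by (simp add: bounded_clinear_add[OF lin] bounded_clinear_scaleC[OF lin] cinner_simps)
  ultimately have "cinner (B x) y = cnj (cinner (B y) x)" by (rule eq_cnj_of_Im_eq_zero)
  then show ?thesis by (simp flip: cinner_commute)
qed

text \<open>The nonnegative quadratic form vanishes at \<open>y\<close>; if \<open>B y\<close> were
  nonzero, a small step from \<open>y\<close> in the direction \<open>- B y\<close> would make it
  negative.\<close>

lemma positive_op_null:
  assumes B: "positive_op B" and 0: "cinner (B y) y = 0"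
  shows "B y = 0"
proof (rule ccontr)
  assume nz: "B y \<noteq> 0"
  have lin: "bounded_clinear B" and nn: "Re (cinner (B x) x) \<ge> 0" for x
    using B by (auto simp: positive_op_def complex_nonneg_Reals_iff)
  define a where "a = (norm (B y))^2"
  define b where "b = Re (cinner (B (B y)) (B y))"
  have a: "a > 0" and b: "b \<ge> 0" using nz nn by (auto simp: a_def b_def)
  have "cinner (B (B y)) y = of_real a"
    using positive_op_symmetric[OF B, of "B y" y] by (simp add: a_def cinner_self)
  then have Q: "- 2 * t * a + t^2 * b \<ge> 0" for t
    using nn[of "y - t *\<^sub>R B y"] 0
    by (simp add: bounded_clinear_diff[OF lin] bounded_clinear_scaleR[OF lin] cinner_simps
        cinner_self a_def b_def power2_eq_square algebra_simps)
  \<comment> \<open>Small enough that \<open>t * b \<le> a\<close>, so that the linear term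
    \<open>- 2 * t * a\<close> dominates; the 1 covers \<open>b = 0\<close>.\<close>
  define t where "t = a / (b + 1)"
  have "t > 0" and "t * b \<le> a" using a b by (auto simp: t_def field_simps)
  then have "t * (t * b - 2 * a) < 0" using a by (intro mult_pos_neg) auto
  with Q[of t] show False by (simp add: power2_eq_square algebra_simps)
qed

text \<open>A fixed point \<open>C\<close> satisfies \<open>(1 - C)^2 = 1 - R\<close>, so
  \<open>1 - C\<close> is a square root of \<open>1 - R\<close>.\<close>

primrec sqrt_iter :: "('a::real_vector \<Rightarrow> 'a) \<Rightarrow> nat \<Rightarrow> 'a \<Rightarrow> 'a" where
  "sqrt_iter R 0 = (\<lambda>x. 0)"
| "sqrt_iter R (Suc n) = (\<lambda>x. (1/2) *\<^sub>R (R x + sqrt_iter R n (sqrt_iter R n x)))"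

primrec sqrt_bound :: "nat \<Rightarrow> real" where
  "sqrt_bound 0 = 0"
| "sqrt_bound (Suc n) = (1 + (sqrt_bound n)^2) / 2"

lemma sqrt_bound_range: "0 \<le> sqrt_bound n \<and> sqrt_bound n \<le> 1"
proof (induction n)
  case (Suc n)
  then have "(sqrt_bound n)^2 \<le> 1" by (simp add: power_le_one)
  then show ?case by simp
qed simp

lemma sqrt_bound_Suc_ge: "sqrt_bound n \<le> sqrt_bound (Suc n)"
  using zero_le_power2[of "1 - sqrt_bound n"] by (simp add: power2_eq_square algebra_simps)

text \<open>The limit of the iteration \<open>C \<mapsto> (R + C\<^sup>2) / 2\<close>; the bounds on its increments are those of the
  scalar iteration with \<open>R = 1\<close>.\<close>

lemma sqrt_iter_limit:
  fixes R :: "'a::complex_hilbert_space \<Rightarrow> 'a"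
  assumes R: "bounded_clinear R" and sym: "\<And>x y. cinner (R x) y = cinner x (R y)"
    and contr: "\<And>x. norm (R x) \<le> norm x"
  obtains C where "bounded_clinear C" "\<And>x y. cinner (C x) y = cinner x (C y)"
    "\<And>x. norm (C x) \<le> norm x" "\<And>x. 2 *\<^sub>R C x = R x + C (C x)"
    "\<And>S. bounded_clinear S \<Longrightarrow> S \<circ> R = R \<circ> S \<Longrightarrow> S \<circ> C = C \<circ> S"
proof -
  define D where "D = sqrt_iter R"
  define c where "c = sqrt_bound"
  have D0: "D 0 x = 0" and DS: "D (Suc n) x = (1/2) *\<^sub>R (R x + D n (D n x))" for n x
    by (simp_all add: D_def)
  have c: "0 \<le> c n" "c n \<le> 1" "c n \<le> c (Suc n)" and cS: "c (Suc n) = (1 + (c n)^2) / 2" for n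
    using sqrt_bound_range[of n] sqrt_bound_Suc_ge[of n] by (simp_all add: c_def)
  have Dlin: "bounded_clinear (D n)" for n
  proof (induction n)
    case 0
    show ?case by (rule bounded_clinearI[where K = 0]) (simp_all add: D0 scaleC_zero)
  next
    case (Suc n)
    have "D (Suc n) = (\<lambda>x. (1/2) *\<^sub>R (R x + (D n \<circ> D n) x))" by (simp add: fun_eq_iff DS)
    then show ?case
      by (simp only:) (intro bounded_clinear_scaleR_op bounded_clinear_add_ops R bounded_clinear_compose Suc)
  qed
  have Dsym: "cinner (D n x) y = cinner x (D n y)" for n x y
    by (induction n arbitrary: x y) (simp_all add: D0 DS cinner_simps sym)
  \<comment> \<open>The iterates are polynomials in \<open>R\<close>: whatever commutes with
    \<open>R\<close> commutes with them, and so they commute with each other.\<close>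
  have Dcomm: "S (D n x) = D n (S x)" if "bounded_clinear S" "\<And>x. S (R x) = R (S x)" for S n x
    using that by (induction n arbitrary: x)
      (simp_all add: D0 DS bounded_clinear_zero bounded_clinear_add bounded_clinear_scaleR)
  have Dcomm2: "D m (D n x) = D n (D m x)" for m n x
    using Dcomm[OF R] by (intro Dcomm Dlin) simp
  have Dbd: "norm (D n x) \<le> c n * norm x" for n x
  proof (induction n arbitrary: x)
    case (Suc n)
    have "norm (D n (D n x)) \<le> c n * (c n * norm x)"
      using Suc[of "D n x"] mult_left_mono[OF Suc[of x] c(1)[of n]] by linarith
    then have "norm (R x + D n (D n x)) \<le> norm x + c n * (c n * norm x)"
      by (intro norm_triangle_le add_mono contr)
    moreover have "norm (D (Suc n) x) = norm (R x + D n (D n x)) / 2" by (simp add: DS)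
    ultimately show ?case by (simp add: cS power2_eq_square algebra_simps)
  qed (simp add: D0 c)
  have Dinc: "norm (D (Suc n) x - D n x) \<le> (c (Suc n) - c n) * norm x" for n x
  proof (induction n arbitrary: x)
    case 0
    show ?case using contr[of x] by (simp add: DS D0 cS) (simp add: c_def)
  next
    case (Suc n)
    define d where "d = D (Suc n) x - D n x"
    have "D (Suc (Suc n)) x - D (Suc n) x
        = (1/2) *\<^sub>R (D (Suc n) (D (Suc n) x) - D n (D n x))"
      unfolding DS[of "Suc n"] by (subst (2) DS) (simp flip: scaleR_diff_right)
    \<comment> \<open>Difference of squares; the mixed terms cancel because the iterates
      commute.\<close>
    also have "D (Suc n) (D (Suc n) x) - D n (D n x) = D (Suc n) d + D n d"
      unfolding d_def bounded_clinear_diff[OF Dlin] using Dcomm2[of "Suc n" n x] by simp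
    finally have eq: "D (Suc (Suc n)) x - D (Suc n) x = (1/2) *\<^sub>R (D (Suc n) d + D n d)" .
    have "norm (D (Suc n) d + D n d) \<le> (c (Suc n) + c n) * norm d"
      using norm_triangle_ineq[of "D (Suc n) d" "D n d"] Dbd[of "Suc n" d] Dbd[of n d]
      by (simp add: algebra_simps)
    also have "\<dots> \<le> (c (Suc n) + c n) * ((c (Suc n) - c n) * norm x)"
      using Suc[of x] c(1)[of n] c(1)[of "Suc n"] by (intro mult_left_mono) (auto simp: d_def)
    also have "\<dots> = ((c (Suc n))^2 - (c n)^2) * norm x"
      by (simp add: power2_eq_square algebra_simps)
    also have "(c n)^2 = 2 * c (Suc n) - 1" by (simp add: cS field_simps)
    also have "((c (Suc n))^2 - (2 * c (Suc n) - 1)) * norm x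
        = 2 * ((c (Suc (Suc n)) - c (Suc n)) * norm x)"
      unfolding cS[of "Suc n"] by (simp add: field_simps)
    finally show ?case unfolding eq by simp
  qed
  \<comment> \<open>The increments telescope; as \<open>c\<close> is increasing and bounded, the
    iterates converge at every vector.\<close>
  have Dinc': "norm (D (n + k) x - D n x) \<le> (c (n + k) - c n) * norm x" for n k x
  proof (induction k)
    case (Suc k)
    have "norm (D (n + Suc k) x - D n x)
        \<le> norm (D (Suc (n + k)) x - D (n + k) x) + norm (D (n + k) x - D n x)"
      by (metis add_Suc_right norm_triangle_ineq diff_add_cancel add_diff_eq)
    also have "\<dots> \<le> (c (Suc (n + k)) - c (n + k)) * norm x + (c (n + k) - c n) * norm x"
      by (intro add_mono Dinc Suc)
    finally show ?case by (simp add: algebra_simps)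
  qed simp
  have "convergent c"
  proof (rule Bseq_monoseq_convergent)
    show "Bseq c" using c by (intro BseqI'[where K = 1]) simp
    show "monoseq c" using c(3) by (intro incseq_imp_monoseq incseq_SucI)
  qed
  then have Cc: "Cauchy c" by (rule convergent_Cauchy)
  have "convergent (\<lambda>n. D n x)" for x
  proof -
    have "Cauchy (\<lambda>n. D n x)"
    proof (rule CauchyI')
      fix e :: real assume e: "e > 0"
      then have "e / (norm x + 1) > 0" by (simp add: add_nonneg_pos)
      then obtain N where N: "\<And>m n. m \<ge> N \<Longrightarrow> n \<ge> N \<Longrightarrow> norm (c m - c n) < e / (norm x + 1)"
        using CauchyD[OF Cc] by blast
      have "dist (D m x) (D n x) < e" if m: "m \<ge> N" "m < n" for m n
      proof -
        have n: "n = m + (n - m)" using m by simp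
        have "dist (D m x) (D n x) \<le> (c n - c m) * norm x"
          using Dinc'[of m "n - m" x] n by (simp add: dist_norm norm_minus_commute)
        also have "\<dots> \<le> (c n - c m) * (norm x + 1)"
          using Dinc'[of m "n - m" 0] n lift_Suc_mono_le[of c m n] c(3) m by (intro mult_left_mono) auto
        also have "\<dots> < e"
        proof -
          have "0 < norm x + 1" by (simp add: add_nonneg_pos)
          moreover have "c n - c m < e / (norm x + 1)" using N[of n m] m by (simp add: abs_less_iff)
          ultimately show ?thesis by (simp add: pos_less_divide_eq)
        qed
        finally show ?thesis .
      qed
      then show "\<exists>M. \<forall>m\<ge>M. \<forall>n>m. dist (D m x) (D n x) < e" by blast
    qed
    then show ?thesis by (simp add: Cauchy_convergent_iff)
  qed
  then obtain C where C: "\<And>x. (\<lambda>n. D n x) \<longlonglongrightarrow> C x" unfolding convergent_def by metis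
  have Cn: "norm (C x) \<le> norm x" for x
  proof (rule LIMSEQ_le_const2[OF tendsto_norm[OF C[of x]]])
    have "norm (D n x) \<le> 1 * norm x" for n
      using Dbd[of n x] mult_right_mono[OF c(2)[of n], of "norm x"] by simp
    then show "\<exists>N. \<forall>n\<ge>N. norm (D n x) \<le> norm x" by simp
  qed
  have Cadd: "C (x + y) = C x + C y" for x y
    using tendsto_add[OF C[of x] C[of y]] C[of "x + y"]
    by (simp add: LIMSEQ_unique flip: bounded_clinear_add[OF Dlin])
  have Csym: "cinner (C x) y = cinner x (C y)" for x y
    using tendsto_cinner[OF C[of x] tendsto_const[of y]] tendsto_cinner[OF tendsto_const[of x] C[of y]]
    by (simp add: LIMSEQ_unique Dsym)
  have Cscale: "C (a *\<^sub>C x) = a *\<^sub>C C x" for a x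
    by (rule cinner_ext) (simp add: cinner_simps flip: Csym)
  have Clin: "bounded_clinear C" using Cadd Cscale Cn by (intro bounded_clinearI[where K = 1]) auto
  \<comment> \<open>The iterates are uniformly contractive, so the pointwise limit passes through
    the square.\<close>
  have "(\<lambda>n. D n (D n x) - D n (C x)) \<longlonglongrightarrow> 0" for x
  proof (rule tendsto_0_le[where K = 1])
    show "(\<lambda>n. D n x - C x) \<longlonglongrightarrow> 0" using C[of x] by (simp add: LIM_zero_iff)
    have "norm (D n (D n x - C x)) \<le> norm (D n x - C x)" for n
      using Dbd[of n "D n x - C x"] mult_right_mono[OF c(2)[of n], of "norm (D n x - C x)"] by simp
    then show "\<forall>\<^sub>F n in sequentially. norm (D n (D n x) - D n (C x)) \<le> norm (D n x - C x) * 1"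
      by (simp add: bounded_clinear_diff[OF Dlin])
  qed
  then have DD: "(\<lambda>n. D n (D n x)) \<longlonglongrightarrow> C (C x)" for x
    using tendsto_add[OF _ C[of "C x"], of "\<lambda>n. D n (D n x) - D n (C x)" 0] by simp
  have "C x = (1/2) *\<^sub>R (R x + C (C x))" for x
  proof (rule LIMSEQ_unique)
    show "(\<lambda>n. D (Suc n) x) \<longlonglongrightarrow> C x" using C by (rule LIMSEQ_Suc)
    show "(\<lambda>n. D (Suc n) x) \<longlonglongrightarrow> (1/2) *\<^sub>R (R x + C (C x))"
      unfolding DS by (intro tendsto_intros DD)
  qed
  then have Ceq: "2 *\<^sub>R C x = R x + C (C x)" for x
    by (metis scaleR_half_double scaleR_2 scaleR_right_distrib)
  have "S (C x) = C (S x)" if S: "bounded_clinear S" "\<And>x. S (R x) = R (S x)" for S x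
  proof (rule LIMSEQ_unique)
    show "(\<lambda>n. D n (S x)) \<longlonglongrightarrow> C (S x)" by (rule C)
    have "bounded_linear S" using S by (simp add: bounded_clinear_def)
    then show "(\<lambda>n. D n (S x)) \<longlonglongrightarrow> S (C x)"
      using bounded_linear.tendsto[OF _ C[of x]] by (simp flip: Dcomm[OF S])
  qed
  then have "S \<circ> C = C \<circ> S" if "bounded_clinear S" "S \<circ> R = R \<circ> S" for S
    using that by (simp add: fun_eq_iff)
  with that[OF Clin Csym Cn Ceq] show ?thesis by blast
qed

text \<open>\<open>P\<close>, the operator \<open>cadjoint A \<circ> A\<close> divided by
  \<open>s^2\<close>, lies between 0 and 1, so \<open>R = 1 - P\<close> is a contraction and the
  iteration yields the root \<open>s * (1 - C)\<close>. The commutation clause serves the uniqueness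
  of the root.\<close>

lemma positive_sqrt_exists:
  fixes A :: "'a::complex_hilbert_space \<Rightarrow> 'a"
  assumes A: "bounded_clinear A"
  obtains B where "positive_op B" "\<And>x. B (B x) = cadjoint A (A x)"
    "\<And>S. bounded_clinear S \<Longrightarrow> S \<circ> (cadjoint A \<circ> A) = cadjoint A \<circ> A \<circ> S \<Longrightarrow> S \<circ> B = B \<circ> S"
proof -
  \<comment> \<open>The added 1 keeps \<open>s\<close> positive for \<open>A = 0\<close>.\<close>
  define s where "s = onorm A + 1"
  have "onorm A \<ge> 0" using A by (simp add: bounded_clinear_def onorm_pos_le)
  then have s: "s > 0" and As: "norm (A x) \<le> s * norm x" for x
    using bounded_clinear_onorm[OF A, of x] by (auto simp: s_def algebra_simps intro: order_trans)
  note A' = bounded_clinear_cadjoint[OF A]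
  define P where "P x = inverse (s^2) *\<^sub>R cadjoint A (A x)" for x
  define R where "R x = x - P x" for x
  have P: "bounded_clinear P"
    using bounded_clinear_scaleR_op[OF bounded_clinear_compose[OF A' A], of "inverse (s^2)"]
    by (simp add: P_def[abs_def] o_def)
  have Psym: "cinner (P x) y = cinner x (P y)" for x y
    using cinner_cadjoint[OF A] by (simp add: P_def cinner_simps) (metis cinner_commute)
  have Pinner: "inner x (P x) = (norm (A x))^2 / s^2" for x
  proof -
    have "inner x (cadjoint A (A x)) = (norm (A x))^2"
      by (simp add: inner_eq_Re_cinner cinner_self flip: cinner_cadjoint[OF A] of_real_power)
    then show ?thesis by (simp add: P_def divide_inverse mult.commute)
  qed
  \<comment> \<open>In operator terms \<open>P^2 \<le> P\<close>; it holds because the adjoint is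
    also bounded by \<open>s\<close>, and it makes \<open>R\<close> a contraction.\<close>
  have Pn: "(norm (P x))^2 \<le> inner x (P x)" for x
  proof -
    have "norm (cadjoint A (A x)) \<le> s * norm (A x)" using s by (intro norm_cadjoint_le A As) auto
    then have "norm (P x) \<le> norm (A x) / s" using s by (simp add: P_def field_simps power2_eq_square)
    then have "(norm (P x))^2 \<le> (norm (A x) / s)^2" by (intro power_mono) auto
    then show ?thesis by (simp add: Pinner power_divide)
  qed
  have Rn: "norm (R x) \<le> norm x" for x
  proof -
    have "(norm (R x))^2 = (norm x)^2 - 2 * inner x (P x) + (norm (P x))^2"
      by (simp add: R_def power2_norm_eq_inner inner_simps inner_commute)
    also have "\<dots> \<le> (norm x)^2" using Pn[of x] zero_le_power2[of "norm (P x)"] by linarith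
    finally show ?thesis by (rule power2_le_imp_le) simp
  qed
  have R: "bounded_clinear R"
  proof (rule bounded_clinearI[where K = 1])
    show "R (x + y) = R x + R y" for x y by (simp add: R_def bounded_clinear_add[OF P])
    show "R (c *\<^sub>C x) = c *\<^sub>C R x" for c x
      by (simp add: R_def bounded_clinear_scaleC[OF P] scaleC_diff_right)
  qed (simp add: Rn)
  have Rsym: "cinner (R x) y = cinner x (R y)" for x y by (simp add: R_def cinner_simps Psym)
  obtain C where C: "bounded_clinear C" and Csym: "\<And>x y. cinner (C x) y = cinner x (C y)"
    and Cn: "\<And>x. norm (C x) \<le> norm x" and Ceq: "\<And>x. 2 *\<^sub>R C x = R x + C (C x)"
    and Ccomm: "\<And>S. bounded_clinear S \<Longrightarrow> S \<circ> R = R \<circ> S \<Longrightarrow> S \<circ> C = C \<circ> S"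
    by (rule sqrt_iter_limit[OF R Rsym Rn]) blast
  define B where "B x = s *\<^sub>R (x - C x)" for x
  have B: "bounded_clinear B"
  proof (rule bounded_clinearI)
    show "norm (B x) \<le> (2 * s) * norm x" for x
      using Cn[of x] norm_triangle_ineq4[of x "C x"] s by (simp add: B_def)
  qed (simp_all add: B_def bounded_clinear_add[OF C] bounded_clinear_scaleC[OF C] scaleC_diff_right
       scaleC_add_right scaleC_scaleC scaleR_scaleC algebra_simps)
  show ?thesis
  proof
    show "positive_op B"
      unfolding positive_op_def
    proof (intro conjI allI B)
      fix x
      have "inner (C x) x \<le> (norm x)^2"
        using norm_cauchy_schwarz[of "C x" x] mult_right_mono[OF Cn[of x], of "norm x"]
        by (simp add: power2_eq_square)
      then have "Re (cinner (B x) x) \<ge> 0"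
        using s by (simp add: B_def cinner_simps cinner_self flip: inner_eq_Re_cinner of_real_power)
      moreover have "cinner (B x) x = cinner x (B x)" by (simp add: B_def cinner_simps Csym)
      then have "Im (cinner (B x) x) = 0" using arg_cong[OF cinner_commute[of x "B x"], of Im] by simp
      ultimately show "cinner (B x) x \<in> \<real>\<^sub>\<ge>\<^sub>0" by (simp add: complex_nonneg_Reals_iff)
    qed
    show "B (B x) = cadjoint A (A x)" for x
    proof -
      have "B (B x) = s^2 *\<^sub>R (x - 2 *\<^sub>R C x + C (C x))"
        by (simp add: B_def bounded_clinear_diff[OF C] bounded_clinear_scaleR[OF C] power2_eq_square
            scaleR_2 algebra_simps)
      also have "\<dots> = s^2 *\<^sub>R P x" by (simp add: Ceq R_def)
      finally show ?thesis using s by (simp add: P_def)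
    qed
    show "S \<circ> B = B \<circ> S"
      if S: "bounded_clinear S" and "S \<circ> (cadjoint A \<circ> A) = cadjoint A \<circ> A \<circ> S" for S
    proof -
      have "S \<circ> C = C \<circ> S"
        using that by (intro Ccomm)
          (simp_all add: fun_eq_iff R_def P_def bounded_clinear_diff bounded_clinear_scaleR)
      then show ?thesis
        using S by (simp add: fun_eq_iff B_def bounded_clinear_diff bounded_clinear_scaleR)
    qed
  qed
qed

text \<open>\<open>abs_op\<close> is a definite description, so the positive root must be shown
  unique. Another root \<open>D\<close> commutes with \<open>D^2\<close> and hence with
  \<open>B\<close>, so \<open>B + D\<close> kills the range of \<open>B - D\<close>; positivity then
  forces \<open>B = D\<close>.\<close>

lemma abs_op_square:
  fixes A :: "'a::complex_hilbert_space \<Rightarrow> 'a"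
  assumes A: "bounded_clinear A"
  shows "(abs_op A ^^ 2) x = cadjoint A (A x)"
proof -
  obtain B where B: "positive_op B" and sq: "\<And>x. B (B x) = cadjoint A (A x)"
    and comm: "\<And>S. bounded_clinear S \<Longrightarrow> S \<circ> (cadjoint A \<circ> A) = cadjoint A \<circ> A \<circ> S
      \<Longrightarrow> S \<circ> B = B \<circ> S"
    by (rule positive_sqrt_exists[OF A]) blast
  have "\<exists>!B. positive_op B \<and> B ^^ 2 = cadjoint A \<circ> A"
  proof (rule ex1I)
    show "positive_op B \<and> B ^^ 2 = cadjoint A \<circ> A" using B by (auto simp: sq numeral_2_eq_2)
    fix D assume "positive_op D \<and> D ^^ 2 = cadjoint A \<circ> A"
    then have D: "positive_op D" and Dsq: "D (D x) = cadjoint A (A x)" for x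
      by (auto simp: fun_eq_iff numeral_2_eq_2)
    have Bl: "bounded_clinear B" and Dl: "bounded_clinear D" using B D by (auto simp: positive_op_def)
    have "D \<circ> B = B \<circ> D" by (intro comm Dl) (simp add: fun_eq_iff flip: Dsq)
    then have DB: "D (B x) = B (D x)" for x by (simp add: fun_eq_iff)
    show "D = B"
    proof
      fix x
      define y where "y = B x - D x"
      have "B y + D y = 0"
        by (simp add: y_def bounded_clinear_diff[OF Bl] bounded_clinear_diff[OF Dl] DB sq Dsq)
      then have "cinner (B y) y + cinner (D y) y = 0" by (metis cinner_add_left cinner_zero(1))
      moreover have "cinner (B y) y \<in> \<real>\<^sub>\<ge>\<^sub>0" "cinner (D y) y \<in> \<real>\<^sub>\<ge>\<^sub>0"
        using B D by (auto simp: positive_op_def)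
      ultimately have "cinner (B y) y = 0" "cinner (D y) y = 0"
        by (auto simp: complex_nonneg_Reals_iff complex_eq_iff)
      then have "B y = 0" "D y = 0" using B D by (auto intro: positive_op_null)
      \<comment> \<open>By symmetry \<open>cinner y y\<close> equals
        \<open>cinner x (B y - D y)\<close>.\<close>
      then have "cinner y y = 0"
        by (subst y_def)
          (simp add: cinner_simps positive_op_symmetric[OF B] positive_op_symmetric[OF D])
      then show "D x = B x" by (simp add: cinner_self y_def)
    qed
  qed
  from theI'[OF this] have "abs_op A ^^ 2 = cadjoint A \<circ> A" by (simp add: abs_op_def)
  then show ?thesis by simp
qed

section \<open>The numerical range form of a \<open>\<rho>\<close>-contraction\<close>

text \<open>If \<open>Q\<close> were negative, \<open>a\<close> would eventually lose at least
  \<open>- Q / 2\<close> at every step and become negative.\<close>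

lemma nonneg_of_recurrence:
  fixes a \<epsilon> :: "nat \<Rightarrow> real"
  assumes a0: "\<And>n. 0 \<le> a n" and rec: "\<And>n. a (Suc n) \<le> Q + \<epsilon> n + q * a n"
    and q: "q \<le> 1" and \<epsilon>: "\<epsilon> \<longlonglongrightarrow> 0"
  shows "0 \<le> Q"
proof (rule ccontr)
  assume "\<not> 0 \<le> Q"
  then have "- Q / 2 > 0" by simp
  then have "\<forall>\<^sub>F n in sequentially. \<epsilon> n < - Q / 2" by (rule order_tendstoD(2)[OF \<epsilon>])
  then obtain N where N: "\<And>n. n \<ge> N \<Longrightarrow> \<epsilon> n < - Q / 2" by (auto simp: eventually_sequentially)
  have step: "a (Suc n) \<le> a n + Q / 2" if "n \<ge> N" for n
    using rec[of n] N[OF that] mult_right_mono[OF q a0[of n]] by linarith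
  have lin: "a (N + k) \<le> a N + real k * (Q / 2)" for k
  proof (induction k)
    case (Suc k)
    then show ?case using step[of "N + k"] by (simp add: field_simps)
  qed simp
  obtain k where "a N < real k * (- Q / 2)" using reals_Archimedean3[OF \<open>- Q / 2 > 0\<close>] by blast
  with lin[of k] a0[of "N + k"] show False by (simp add: field_simps)
qed

text \<open>Let \<open>w\<^sub>n = \<Sum>\<^sub>k\<^sub>\<le>\<^sub>n z\<^sup>k U\<^sup>k h\<close>, where \<open>h = g - z X g\<close>.  Since \<open>w\<^sub>n\<^sub>+\<^sub>1 = h + z U w\<^sub>n\<close>, and since the inner
  product of \<open>z U w\<^sub>n\<close> with \<open>h\<close> telescopes, \<open>\<parallel>w\<^sub>n\<^sub>+\<^sub>1\<parallel>\<^sup>2 - \<bar>z\<bar>\<^sup>2 \<parallel>w\<^sub>n\<parallel>\<^sup>2\<close> converges to the expression below.\<close>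

lemma rho_contraction_resolvent_form:
  fixes X :: "'a::complex_hilbert_space \<Rightarrow> 'a"
  assumes X: "rho_contraction \<rho> X" and \<rho>: "\<rho> > 0" and z: "cmod z < 1"
  defines "h \<equiv> \<lambda>g. g - z *\<^sub>C X g"
  shows "0 \<le> (norm (h g))^2 + 2 / \<rho> * Re (cinner (z *\<^sub>C X g) (h g))"
proof -
  define h0 where "h0 = h g"
  from X obtain K :: "(int \<Rightarrow> 'a \<Rightarrow> complex) hilbert" and V U P
    where lin: "bounded_clinear X" and "hilbert K" and V: "isometric_embedding K V"
      and U: "unitary_on K U" and P: "orth_projection K (range V) P"
      and pow: "\<And>n x. n \<ge> 1 \<Longrightarrow> V ((X ^^ n) x) = vscale K (complex_of_real \<rho>) (P ((U ^^ n) (V x)))"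
    by (auto simp: rho_contraction_def rho_dilation_def)
  interpret hilbert K by fact
  have V: "V x \<in> pts K" "vip K (V x) (V y) = cinner x y" for x y
    using V by (auto simp: isometric_embedding_def)
  have Ucl: "U x \<in> pts K" if "x \<in> pts K" for x
    using U that by (auto simp: unitary_on_def)
  have Uadd: "U (vadd K x y) = vadd K (U x) (U y)" if "x \<in> pts K" "y \<in> pts K" for x y
    using U that by (auto simp: unitary_on_def)
  have Uscale: "U (vscale K c x) = vscale K c (U x)" if "x \<in> pts K" for c x
    using U that by (auto simp: unitary_on_def)
  have Uip: "vip K (U x) (U y) = vip K x y" if "x \<in> pts K" "y \<in> pts K" for x y
    using U that by (auto simp: unitary_on_def)
  have Upcl: "(U ^^ n) (V x) \<in> pts K" for n x
    by (induction n) (auto simp: Ucl V)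
  have Upip: "vip K ((U ^^ n) (V x)) ((U ^^ n) (V x)) = cinner x x" for n x
    by (induction n) (auto simp: Uip Upcl V)
  \<comment> \<open>The projection error is orthogonal to the range of \<open>V\<close>, so the
    dilation identity can be read off from inner products.\<close>
  have compress: "\<rho> * vip K ((U ^^ n) (V x)) (V y) = cinner ((X ^^ n) x) y" if "n \<ge> 1" for n x y
  proof -
    have Pcl: "P ((U ^^ n) (V x)) \<in> pts K"
    proof -
      have "P ((U ^^ n) (V x)) \<in> range V" using P Upcl by (simp add: orth_projection_def)
      then show ?thesis using V(1) by auto
    qed
    have "vip K (vadd K ((U ^^ n) (V x)) (vscale K (-1) (P ((U ^^ n) (V x))))) (V y) = 0"
      using P Upcl by (simp add: orth_projection_def)
    then have "vip K ((U ^^ n) (V x)) (V y) = vip K (P ((U ^^ n) (V x))) (V y)"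
      by (simp add: ip_add_left ip_scale_left Pcl Upcl V scale_closed)
    moreover have "cinner ((X ^^ n) x) y = \<rho> * vip K (P ((U ^^ n) (V x))) (V y)"
      unfolding V(2)[symmetric] pow[OF that] by (simp add: ip_scale_left Pcl V)
    ultimately show ?thesis by simp
  qed
  \<comment> \<open>The bound is uniform in \<open>n\<close>; with \<open>cmod z < 1\<close> it
    makes the remainder of the telescoping sum vanish.\<close>
  have X_bd: "cmod (cinner ((X ^^ n) x) y) \<le> \<rho> * (norm x * norm y)" if "n \<ge> 1" for n x y
  proof -
    have "cmod (cinner ((X ^^ n) x) y) = \<rho> * cmod (vip K ((U ^^ n) (V x)) (V y))"
      using \<rho> by (simp add: norm_mult flip: compress[OF that])
    also have "\<dots> \<le> \<rho> * (norm x * norm y)"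
      using Cauchy_Schwarz[OF Upcl[of n x] V(1)[of y]] \<rho>
      by (intro mult_left_mono) (simp_all add: Upip V cinner_self flip: of_real_power)
    finally show ?thesis .
  qed
  have Xh: "(X ^^ n) h0 = (X ^^ n) g - z *\<^sub>C (X ^^ Suc n) g" for n
    by (induction n)
      (simp_all add: h0_def h_def bounded_clinear_diff[OF lin] bounded_clinear_scaleC[OF lin])

  \<comment> \<open>The Horner form \<open>wS\<close> serves the norm computation;
    \<open>w_add\<close> below builds the same sums by appending a last term, as the telescoping
    requires.\<close>
  define w where "w = rec_nat (V h0) (\<lambda>_ w. vadd K (V h0) (vscale K z (U w)))"
  have w0: "w 0 = V h0" and wS: "w (Suc n) = vadd K (V h0) (vscale K z (U (w n)))" for n
    by (simp_all add: w_def)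
  have wcl: "w n \<in> pts K" for n
    by (induction n) (auto simp: w0 wS V Ucl add_closed scale_closed)
  define e where "e n = vscale K (z ^ n) ((U ^^ n) (V h0))" for n
  have ecl: "e n \<in> pts K" for n by (simp add: e_def scale_closed Upcl)
  have eS: "vscale K z (U (e n)) = e (Suc n)" for n
    by (simp add: e_def Uscale Upcl scale_scale Ucl)
  have w_add: "w (Suc n) = vadd K (w n) (e (Suc n))" for n
  proof (induction n)
    case 0
    show ?case by (simp add: wS w0 e_def)
  next
    case (Suc n)
    have "w (Suc (Suc n)) = vadd K (V h0) (vadd K (vscale K z (U (w n))) (e (Suc (Suc n))))"
      unfolding wS[of "Suc n"] by (subst Suc)
        (simp add: Uadd wcl ecl scale_add_right Ucl eS)
    also have "\<dots> = vadd K (w (Suc n)) (e (Suc (Suc n)))"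
      by (simp add: wS add_assoc V scale_closed Ucl wcl ecl)
    finally show ?case .
  qed
  have e_ip: "\<rho> * vip K (e (Suc n)) (V h0)
      = z ^ Suc n * (cinner ((X ^^ Suc n) g) h0 - z * cinner ((X ^^ Suc (Suc n)) g) h0)" for n
  proof -
    have "\<rho> * vip K (e (Suc n)) (V h0) = z ^ Suc n * cinner ((X ^^ Suc n) h0) h0"
      using compress[of "Suc n" h0 h0] Upcl[of "Suc n" h0] V(1)[of h0]
      by (simp add: e_def ip_scale_left del: funpow.simps)
    then show ?thesis unfolding Xh by (simp add: cinner_simps)
  qed
  \<comment> \<open>Since \<open>h0\<close> is \<open>g - z *\<^sub>C X g\<close>, each term
    contributes a difference at consecutive powers of \<open>X\<close>; only the first and the last
    survive.\<close>
  have tele: "\<rho> * vip K (vscale K z (U (w n))) (V h0)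
      = z * cinner (X g) h0 - z ^ Suc (Suc n) * cinner ((X ^^ Suc (Suc n)) g) h0" for n
  proof (induction n)
    case 0
    have "vscale K z (U (w 0)) = e (Suc 0)" by (simp add: w0 e_def)
    then show ?case using e_ip[of 0] by (simp add: algebra_simps)
  next
    case (Suc n)
    have "vscale K z (U (w (Suc n))) = vadd K (vscale K z (U (w n))) (e (Suc (Suc n)))"
      by (subst w_add) (simp add: Uadd wcl ecl scale_add_right Ucl eS)
    then have "\<rho> * vip K (vscale K z (U (w (Suc n)))) (V h0)
        = \<rho> * vip K (vscale K z (U (w n))) (V h0) + \<rho> * vip K (e (Suc (Suc n))) (V h0)"
      by (simp add: ip_add_left scale_closed Ucl wcl ecl V algebra_simps)
    then show ?case unfolding Suc e_ip by (simp add: algebra_simps)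
  qed

  define a where "a n = Re (vip K (w n) (w n))" for n
  \<comment> \<open>The bound on the telescoping remainder, times \<open>2 / \<rho>\<close>; the
    factor \<rho> from \<open>X_bd\<close> cancels.\<close>
  define \<epsilon> where "\<epsilon> n = 2 * cmod z ^ Suc (Suc n) * (norm g * norm h0)" for n
  have "0 \<le> (norm h0)^2 + 2 / \<rho> * Re (z * cinner (X g) h0)"
  proof (rule nonneg_of_recurrence)
    show "0 \<le> a n" for n unfolding a_def by (intro ip_nonneg wcl)
    show "(cmod z)^2 \<le> 1" using z by (simp add: power_le_one)
    have "(\<lambda>n. cmod z ^ Suc (Suc n)) \<longlonglongrightarrow> 0"
      using LIMSEQ_power_zero[of "cmod z"] z by (intro LIMSEQ_Suc) simp
    then have "(\<lambda>n. 2 * cmod z ^ Suc (Suc n) * (norm g * norm h0)) \<longlonglongrightarrow> 2 * 0 * (norm g * norm h0)"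
      by (intro tendsto_intros)
    then show "\<epsilon> \<longlonglongrightarrow> 0" by (simp add: \<epsilon>_def[abs_def])
    show "a (Suc n) \<le> (norm h0)^2 + 2 / \<rho> * Re (z * cinner (X g) h0) + \<epsilon> n + (cmod z)^2 * a n" for n
    proof -
      define v where "v = vscale K z (U (w n))"
      have vcl: "v \<in> pts K" by (simp add: v_def scale_closed Ucl wcl)
      have "Re (vip K v v) = (cmod z)^2 * a n"
        unfolding v_def a_def
        by (simp add: ip_scale_left ip_scale_right scale_closed Ucl wcl Uip
            flip: mult.assoc complex_norm_square of_real_power)
          (simp add: cmod_power2 flip: power2_eq_square)
      moreover have "Re (vip K (V h0) v) = Re (vip K v (V h0))"
        using ip_commute[OF V(1) vcl] by simp
      ultimately have "a (Suc n) = (norm h0)^2 + 2 * Re (vip K v (V h0)) + (cmod z)^2 * a n"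
        unfolding a_def[of "Suc n"] wS v_def[symmetric]
        by (simp add: ip_add_left ip_add_right vcl V add_closed cinner_self flip: of_real_power)
      moreover have "\<rho> * Re (vip K v (V h0)) \<le> Re (z * cinner (X g) h0)
          + cmod z ^ Suc (Suc n) * (\<rho> * (norm g * norm h0))"
      proof -
        have "cmod (z ^ Suc (Suc n) * cinner ((X ^^ Suc (Suc n)) g) h0)
            \<le> cmod z ^ Suc (Suc n) * (\<rho> * (norm g * norm h0))"
          unfolding norm_mult norm_power by (intro mult_left_mono X_bd) auto
        then show ?thesis
          using arg_cong[OF tele[of n], of Re] abs_Re_le_cmod[of "z ^ Suc (Suc n) * cinner ((X ^^ Suc (Suc n)) g) h0"]
          unfolding v_def by (simp del: power_Suc funpow.simps)
      qed
      then have "2 * Re (vip K v (V h0)) \<le> 2 / \<rho> * Re (z * cinner (X g) h0) + \<epsilon> n"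
        using \<rho> by (simp add: \<epsilon>_def field_simps)
      ultimately show ?thesis by simp
    qed
  qed
  then show ?thesis by (simp add: h0_def cinner_simps)
qed

text \<open>The resolvent form at \<open>r * z\<close> with \<open>r < 1\<close> is expanded into a
  quadratic polynomial \<open>F\<close> in \<open>r\<close>, and then \<open>r\<close> tends to
  1.\<close>

lemma rho_contraction_form:
  fixes X :: "'a::complex_hilbert_space \<Rightarrow> 'a"
  assumes X: "rho_contraction \<rho> X" and \<rho>: "\<rho> > 0" and z: "cmod z = 1"
  shows "(2 / \<rho> - 1) * (norm (X g))^2 \<le> (norm g)^2 + (2 / \<rho> - 2) * Re (z * cinner (X g) g)"
proof -
  define q where "q = Re (z * cinner (X g) g)"
  define F where "F r = (norm g)^2 + (2 / \<rho> - 2) * (r * q) - (2 / \<rho> - 1) * (r^2 * (norm (X g))^2)" for r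
  have "F r \<ge> 0" if r: "0 < r" "r < 1" for r
  proof -
    define u where "u = (r * z) *\<^sub>C X g"
    have "Re (cinner u g) = r * q" by (simp add: u_def q_def cinner_simps mult.assoc)
    moreover have "norm u = r * norm (X g)" using r z by (simp add: u_def norm_scaleC norm_mult)
    moreover have "0 \<le> (norm (g - u))^2 + 2 / \<rho> * Re (cinner u (g - u))"
      unfolding u_def using r z
      by (intro rho_contraction_resolvent_form[OF X \<rho>]) (simp add: norm_mult)
    moreover have "(norm (g - u))^2 = (norm g)^2 - 2 * Re (cinner u g) + (norm u)^2"
      unfolding power2_norm_eq_inner inner_eq_Re_cinner[symmetric]
      by (simp add: inner_simps inner_commute)
    moreover have "Re (cinner u (g - u)) = Re (cinner u g) - (norm u)^2"
      by (simp add: cinner_simps cinner_self flip: of_real_power)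
    ultimately show ?thesis by (simp add: F_def power_mult_distrib algebra_simps)
  qed
  then have ev: "\<forall>\<^sub>F r in at_left 1. 0 \<le> F r"
    using eventually_at_left[of 0 1] by (metis zero_less_one)
  have "(F \<longlongrightarrow> F 1) (at_left 1)" unfolding F_def by (intro tendsto_intros)
  then have "0 \<le> F 1" using ev by (rule tendsto_lowerbound) simp
  then show ?thesis by (simp add: F_def q_def)
qed

text \<open>The left-hand side is \<open>\<bar>\<langle>T u, u\<rangle>\<bar>\<close> for \<open>T = [[0, \<alpha> X], [0, \<beta> X]]\<close> and \<open>u = (x, y)\<close>.\<close>

lemma rho_contraction_numerical_range:
  fixes X :: "'a::complex_hilbert_space \<Rightarrow> 'a"
  assumes X: "rho_contraction \<rho> X" and \<rho>: "0 < \<rho>" "\<rho> \<le> 2"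
  shows "cmod (sqrt (8 * inverse \<rho> - 4) * cinner (X y) x + complex_of_real (2 * inverse \<rho> - 2) * cinner (X y) y)
    \<le> (norm x)^2 + (norm y)^2"
proof -
  define \<alpha> \<beta> where "\<alpha> = sqrt (8 * inverse \<rho> - 4)" and "\<beta> = 2 * inverse \<rho> - 2"
  have \<alpha>: "\<alpha> \<ge> 0" "\<alpha>^2 = 4 * (2 / \<rho> - 1)" using \<rho> by (simp_all add: \<alpha>_def field_simps)
  define s where "s = \<alpha> * cinner (X y) x + \<beta> * cinner (X y) y"
  obtain c where c: "cmod c = 1" "c * s = of_real (cmod s)" by (rule unimodular_rotation)
  have "cmod s = Re (c * s)" by (simp add: c)
  also have "\<dots> = \<alpha> * Re (c * cinner (X y) x) + \<beta> * Re (c * cinner (X y) y)"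
    by (simp add: s_def algebra_simps)
  also have "\<dots> \<le> \<alpha> * (norm (X y) * norm x) + (norm y)^2 - (\<alpha> / 2)^2 * (norm (X y))^2"
  proof -
    have "Re (c * cinner (X y) x) \<le> norm (X y) * norm x"
      using cinner_Cauchy_Schwarz[of "X y" x] complex_Re_le_cmod[of "c * cinner (X y) x"] c
      by (simp add: norm_mult)
    then have 1: "\<alpha> * Re (c * cinner (X y) x) \<le> \<alpha> * (norm (X y) * norm x)"
      using \<alpha> by (intro mult_left_mono)
    \<comment> \<open>Applying the form inequality to \<open>- c\<close> turns it into an upper
      bound for the \<beta> term.\<close>
    have "cmod (- c) = 1" using c by simp
    moreover have "Re (- c * cinner (X y) y) = - Re (c * cinner (X y) y)" by simp
    ultimately have 2: "\<beta> * Re (c * cinner (X y) y) \<le> (norm y)^2 - (2 / \<rho> - 1) * (norm (X y))^2"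
      using rho_contraction_form[OF X \<rho>(1), of "- c" y]
      by (simp add: \<beta>_def divide_inverse del: times_complex.sel)
    have "(\<alpha> / 2)^2 = 2 / \<rho> - 1" by (simp add: power_divide \<alpha>(2))
    with 1 2 show ?thesis by simp
  qed
  \<comment> \<open>Completing the square in \<open>norm x\<close> and
    \<open>\<alpha> / 2 * norm (X y)\<close>.\<close>
  also have "\<dots> \<le> (norm x)^2 + (norm y)^2"
    using zero_le_power2[of "norm x - \<alpha> / 2 * norm (X y)"] by (simp add: power2_eq_square algebra_simps)
  finally show ?thesis by (simp add: s_def \<alpha>_def \<beta>_def)
qed

lemma rho_contraction_scaled_numerical_range:
  fixes X :: "'a::complex_hilbert_space \<Rightarrow> 'a"
  assumes X: "rho_contraction \<rho> (\<lambda>x. inverse t *\<^sub>R X x)" and \<rho>: "0 < \<rho>" "\<rho> \<le> 2" and t: "t > 0"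
  shows "cmod (sqrt (8 * inverse \<rho> - 4) * cinner (X y) x + complex_of_real (2 * inverse \<rho> - 2) * cinner (X y) y)
    \<le> t * ((norm x)^2 + (norm y)^2)"
proof -
  let ?s = "\<lambda>y'. sqrt (8 * inverse \<rho> - 4) * cinner y' x + complex_of_real (2 * inverse \<rho> - 2) * cinner y' y"
  have "?s (inverse t *\<^sub>R X y) = complex_of_real (inverse t) * ?s (X y)"
    unfolding cinner_simps by (simp only: distrib_left mult_ac)
  then have "cmod (?s (inverse t *\<^sub>R X y)) = inverse t * cmod (?s (X y))"
    using t by (simp only: norm_mult norm_of_real abs_inverse abs_of_pos)
  then have "inverse t * cmod (?s (X y)) \<le> (norm x)^2 + (norm y)^2"
    using rho_contraction_numerical_range[OF X \<rho>, of y x] by simp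
  then show ?thesis using t by (simp add: inverse_eq_divide pos_divide_le_eq mult.commute)
qed

section \<open>Square summable bilateral sequences\<close>

text \<open>Indexing by all integers makes the shift surjective, hence unitary.\<close>

typedef (overloaded) 'a l2 = "{f :: int \<Rightarrow> 'a::complex_inner. (\<lambda>n. (norm (f n))^2) summable_on UNIV}"
  morphisms l2_nth Abs_l2
  by (rule exI[of _ "\<lambda>_. 0"]) simp

setup_lifting type_definition_l2

lemma l2_summable: "(\<lambda>n. (norm (l2_nth f n))^2) summable_on UNIV"
  using l2_nth[of f] by simp

lemma square_summable_add:
  fixes f g :: "int \<Rightarrow> 'a::real_inner"
  assumes "(\<lambda>n. (norm (f n))^2) summable_on UNIV" "(\<lambda>n. (norm (g n))^2) summable_on UNIV"
  shows "(\<lambda>n. (norm (f n + g n))^2) summable_on UNIV"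
proof (rule summable_on_comparison_test)
  show "(\<lambda>n. 2 * (norm (f n))^2 + 2 * (norm (g n))^2) summable_on UNIV"
    by (intro summable_on_add summable_on_cmult_right assms)
  show "(norm (f n + g n))^2 \<le> 2 * (norm (f n))^2 + 2 * (norm (g n))^2" for n
    using zero_le_power2[of "norm (f n - g n)"]
    by (simp add: power2_norm_eq_inner inner_simps inner_commute)
qed simp

text \<open>The injection \<open>h\<close> covers pointwise bounds (\<open>h = id\<close>) and
  shifted sequences at once.\<close>

lemma square_summable_bound:
  fixes f :: "int \<Rightarrow> 'a::real_normed_vector" and g :: "int \<Rightarrow> 'b::real_normed_vector"
  assumes f: "(\<lambda>n. (norm (f n))^2) summable_on UNIV" and h: "inj h"
    and g: "\<And>n. norm (g n) \<le> K * norm (f (h n))"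
  shows "(\<lambda>n. (norm (g n))^2) summable_on UNIV"
proof (rule summable_on_comparison_test)
  have "(\<lambda>n. (norm (f n))^2) summable_on range h" using f by (rule summable_on_subset_banach) simp
  then have "(\<lambda>n. (norm (f (h n)))^2) summable_on UNIV"
    using summable_on_reindex[OF h, of "\<lambda>n. (norm (f n))^2"] by (simp add: o_def)
  then show "(\<lambda>n. K^2 * (norm (f (h n)))^2) summable_on UNIV" by (rule summable_on_cmult_right)
  show "(norm (g n))^2 \<le> K^2 * (norm (f (h n)))^2" for n
    using power_mono[OF g[of n], of 2] by (simp add: power_mult_distrib)
qed simp

lemma square_summable_inner:
  fixes f g :: "int \<Rightarrow> 'a::complex_inner"
  assumes f: "(\<lambda>n. (norm (f n))^2) summable_on UNIV" and g: "(\<lambda>n. (norm (g n))^2) summable_on UNIV"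
  shows "(\<lambda>n. cinner (f n) (g n)) summable_on UNIV"
proof (rule abs_summable_summable, rule summable_on_comparison_test)
  show "(\<lambda>n. (norm (f n))^2 + (norm (g n))^2) summable_on UNIV"
    by (intro summable_on_add f g)
  show "norm (cinner (f n) (g n)) \<le> (norm (f n))^2 + (norm (g n))^2" for n
  proof -
    have "0 \<le> norm (f n) * norm (g n)" by simp
    then show ?thesis
      using cinner_Cauchy_Schwarz[of "f n" "g n"] sum_squares_bound[of "norm (f n)" "norm (g n)"]
      unfolding mult.assoc by linarith
  qed
qed simp

instantiation l2 :: (complex_inner) complex_inner
begin

lift_definition zero_l2 :: "'a l2" is "\<lambda>_. 0" by simp

lift_definition plus_l2 :: "'a l2 \<Rightarrow> 'a l2 \<Rightarrow> 'a l2" is "\<lambda>f g n. f n + g n"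
  by (simp add: square_summable_add)

lift_definition uminus_l2 :: "'a l2 \<Rightarrow> 'a l2" is "\<lambda>f n. - f n" by simp

lift_definition minus_l2 :: "'a l2 \<Rightarrow> 'a l2 \<Rightarrow> 'a l2" is "\<lambda>f g n. f n - g n"
proof -
  fix f g :: "int \<Rightarrow> 'a"
  assume "(\<lambda>n. (norm (f n))^2) summable_on UNIV" "(\<lambda>n. (norm (g n))^2) summable_on UNIV"
  then show "(\<lambda>n. (norm (f n - g n))^2) summable_on UNIV"
    using square_summable_add[of f "\<lambda>n. - g n"] by simp
qed

lift_definition scaleC_l2 :: "complex \<Rightarrow> 'a l2 \<Rightarrow> 'a l2" is "\<lambda>c f n. c *\<^sub>C f n"
  by (erule square_summable_bound[where h = id]) (auto simp: norm_scaleC)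

lift_definition scaleR_l2 :: "real \<Rightarrow> 'a l2 \<Rightarrow> 'a l2" is "\<lambda>r f n. r *\<^sub>R f n"
  by (erule square_summable_bound[where h = id]) auto

lift_definition cinner_l2 :: "'a l2 \<Rightarrow> 'a l2 \<Rightarrow> complex"
  is "\<lambda>f g. \<Sum>\<^sub>\<infinity>n. cinner (f n) (g n)" .

definition inner_l2 :: "'a l2 \<Rightarrow> 'a l2 \<Rightarrow> real" where "inner_l2 f g = Re (cinner f g)"
definition norm_l2 :: "'a l2 \<Rightarrow> real" where "norm_l2 f = sqrt (inner f f)"
definition dist_l2 :: "'a l2 \<Rightarrow> 'a l2 \<Rightarrow> real" where "dist_l2 f g = norm (f - g)"
definition sgn_l2 :: "'a l2 \<Rightarrow> 'a l2" where "sgn_l2 f = inverse (norm f) *\<^sub>R f"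
definition uniformity_l2 :: "('a l2 \<times> 'a l2) filter" where
  "uniformity_l2 = (INF e\<in>{0<..}. principal {(x, y). dist x y < e})"
definition open_l2 :: "'a l2 set \<Rightarrow> bool" where
  "open_l2 S = (\<forall>x\<in>S. \<forall>\<^sub>F (x', y) in uniformity. x' = x \<longrightarrow> y \<in> S)"

instance
proof
  fix x y z :: "'a l2" and c d :: complex and r s :: real
  show "x + y + z = x + (y + z)" "x + y = y + x" "0 + x = x" "- x + x = 0" "x - y = x + - y"
    "r *\<^sub>R (x + y) = r *\<^sub>R x + r *\<^sub>R y" "(r + s) *\<^sub>R x = r *\<^sub>R x + s *\<^sub>R x"
    "r *\<^sub>R s *\<^sub>R x = (r * s) *\<^sub>R x" "1 *\<^sub>R x = x"
    by (transfer; simp add: algebra_simps)+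
  show "c *\<^sub>C (x + y) = c *\<^sub>C x + c *\<^sub>C y" "(c + d) *\<^sub>C x = c *\<^sub>C x + d *\<^sub>C x"
    "c *\<^sub>C d *\<^sub>C x = (c * d) *\<^sub>C x" "complex_of_real r *\<^sub>C x = r *\<^sub>R x"
    by (transfer; simp add: scaleC_add_right scaleC_add_left scaleC_scaleC scaleC_of_real)+
  show c_comm: "cinner x y = cnj (cinner y x)" for x y :: "'a l2"
    by transfer (subst cinner_commute, simp add: infsum_cnj)
  show c_add: "cinner (x + y) z = cinner x z + cinner y z" for x y z :: "'a l2"
    by transfer (simp add: cinner_simps infsum_add square_summable_inner)
  show c_scale: "cinner (c *\<^sub>C x) y = c * cinner x y" for c and x y :: "'a l2"
    by transfer (simp add: cinner_simps infsum_cmult_right')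
  have c_scaleR: "cinner (r *\<^sub>R x) y = of_real r * cinner x y"
    by transfer (simp add: cinner_simps infsum_cmult_right')
  have c_self: "cinner x x = of_real (\<Sum>\<^sub>\<infinity>n. (norm (l2_nth x n))^2)"
    unfolding cinner_l2.rep_eq unfolding cinner_self
    by (intro infsumI has_sum_of_real has_sum_infsum l2_summable)
  show "dist x y = norm (x - y)" by (simp add: dist_l2_def)
  show "sgn x = inverse (norm x) *\<^sub>R x" by (simp add: sgn_l2_def)
  show "uniformity = (INF e\<in>{0<..}. principal {(x, y :: 'a l2). dist x y < e})"
    by (simp add: uniformity_l2_def)
  show "open U = (\<forall>x\<in>U. \<forall>\<^sub>F (x', y) in uniformity. x' = x \<longrightarrow> y \<in> U)" for U :: "'a l2 set"
    by (simp add: open_l2_def)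
  show "inner x y = inner y x" by (subst inner_l2_def, subst c_comm) (simp add: inner_l2_def)
  show "inner (x + y) z = inner x z + inner y z" by (simp add: inner_l2_def c_add)
  show "inner (r *\<^sub>R x) y = r * inner x y" by (simp add: inner_l2_def c_scaleR)
  show "0 \<le> inner x x" by (simp add: inner_l2_def c_self infsum_nonneg)
  show "inner x x = 0 \<longleftrightarrow> x = 0"
  proof
    assume "inner x x = 0"
    then have "(\<Sum>\<^sub>\<infinity>n. (norm (l2_nth x n))^2) = 0" by (simp add: inner_l2_def c_self)
    then have "(norm (l2_nth x n))^2 = 0" for n
      using nonneg_infsum_le_0D[OF _ l2_summable[of x]] by simp
    then show "x = 0" by (simp add: l2_nth_inject[symmetric] zero_l2.rep_eq fun_eq_iff)
  next
    assume x: "x = 0"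
    show "inner x x = 0" unfolding inner_l2_def c_self by (simp add: x zero_l2.rep_eq)
  qed
  show "norm x = sqrt (inner x x)" by (simp add: norm_l2_def)
  show "inner x y = Re (cinner x y)" by (simp add: inner_l2_def)
qed

end

lemma norm_l2_square: "(norm f)^2 = (\<Sum>\<^sub>\<infinity>n. (norm (l2_nth f n))^2)" for f :: "'a::complex_inner l2"
proof -
  have "cinner f f = of_real (\<Sum>\<^sub>\<infinity>n. (norm (l2_nth f n))^2)"
    unfolding cinner_l2.rep_eq unfolding cinner_self
    by (intro infsumI has_sum_of_real has_sum_infsum l2_summable)
  then show ?thesis by (simp only: cinner_self of_real_eq_iff)
qed

lemma sum_le_norm_l2: "finite F \<Longrightarrow> (\<Sum>n\<in>F. (norm (l2_nth f n))^2) \<le> (norm f)^2"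
  for f :: "'a::complex_inner l2"
  unfolding norm_l2_square by (intro finite_sum_le_infsum l2_summable) auto

lemma norm_l2_nth_le: "norm (l2_nth f n) \<le> norm (f :: 'a::complex_inner l2)"
  using sum_le_norm_l2[of "{n}" f] by (intro power2_le_imp_le[OF _ norm_ge_zero]) simp

instance l2 :: (complex_hilbert_space) complex_hilbert_space
proof
  fix s :: "nat \<Rightarrow> 'a l2" assume s: "Cauchy s"
  have "Cauchy (\<lambda>k. l2_nth (s k) n)" for n
  proof (rule metric_CauchyI)
    fix e :: real assume "e > 0"
    then obtain M where M: "\<And>i j. i \<ge> M \<Longrightarrow> j \<ge> M \<Longrightarrow> dist (s i) (s j) < e"
      using metric_CauchyD[OF s] by blast
    have "dist (l2_nth (s i) n) (l2_nth (s j) n) \<le> dist (s i) (s j)" for i j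
      using norm_l2_nth_le[of "s i - s j" n] by (simp add: dist_norm minus_l2.rep_eq)
    then show "\<exists>M. \<forall>i\<ge>M. \<forall>j\<ge>M. dist (l2_nth (s i) n) (l2_nth (s j) n) < e"
      using M by (meson le_less_trans)
  qed
  then have "\<exists>l. (\<lambda>k. l2_nth (s k) n) \<longlonglongrightarrow> l" for n
    by (simp add: Cauchy_convergent_iff convergent_def)
  then obtain g where g: "\<And>n. (\<lambda>k. l2_nth (s k) n) \<longlonglongrightarrow> g n" by metis
  \<comment> \<open>On finite sums the limit in \<open>j\<close> may be taken coordinatewise; the
    bound does not depend on \<open>F\<close> and so extends to the whole series.\<close>
  have tail: "(\<Sum>n\<in>F. (norm (l2_nth (s i) n - g n))^2) \<le> e^2"
    if F: "finite F" and e: "e > 0" and M: "\<And>j. j \<ge> M \<Longrightarrow> dist (s i) (s j) < e" for F e i M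
  proof (rule LIMSEQ_le_const2)
    show "(\<lambda>j. \<Sum>n\<in>F. (norm (l2_nth (s i) n - l2_nth (s j) n))^2)
        \<longlonglongrightarrow> (\<Sum>n\<in>F. (norm (l2_nth (s i) n - g n))^2)"
      by (intro tendsto_intros g)
    have "(\<Sum>n\<in>F. (norm (l2_nth (s i) n - l2_nth (s j) n))^2) \<le> e^2" if "j \<ge> M" for j
    proof -
      have "(\<Sum>n\<in>F. (norm (l2_nth (s i) n - l2_nth (s j) n))^2) \<le> (norm (s i - s j))^2"
        using sum_le_norm_l2[OF F, of "s i - s j"] by (simp add: minus_l2.rep_eq)
      also have "\<dots> \<le> e^2" using M[OF that] by (intro power_mono) (auto simp: dist_norm)
      finally show ?thesis .
    qed
    then show "\<exists>N. \<forall>j\<ge>N. (\<Sum>n\<in>F. (norm (l2_nth (s i) n - l2_nth (s j) n))^2) \<le> e^2" by blast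
  qed
  have summ: "(\<lambda>n. (norm (l2_nth (s i) n - g n))^2) summable_on UNIV"
    if "e > 0" "\<And>j. j \<ge> M \<Longrightarrow> dist (s i) (s j) < e" for e i M
  proof (rule nonneg_bdd_above_summable_on)
    show "bdd_above (sum (\<lambda>n. (norm (l2_nth (s i) n - g n))^2) ` {F. F \<subseteq> UNIV \<and> finite F})"
      using tail[OF _ that] by (auto simp: bdd_above_def)
  qed simp
  \<comment> \<open>\<open>g\<close> is square summable because it differs from \<open>s M0\<close>
    by a square summable sequence.\<close>
  obtain M0 where "\<And>i j. i \<ge> M0 \<Longrightarrow> j \<ge> M0 \<Longrightarrow> dist (s i) (s j) < 1"
    using metric_CauchyD[OF s, of 1] by auto
  then have "(\<lambda>n. (norm (l2_nth (s M0) n - g n))^2) summable_on UNIV"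
    by (intro summ[of 1 M0]) auto
  then have "(\<lambda>n. (norm (g n - l2_nth (s M0) n))^2) summable_on UNIV"
    by (simp add: norm_minus_commute)
  from square_summable_add[OF this l2_summable[of "s M0"]]
  have gs: "(\<lambda>n. (norm (g n))^2) summable_on UNIV" by simp
  define l where "l = Abs_l2 g"
  have l: "l2_nth l = g" using gs by (simp add: l_def Abs_l2_inverse)
  have "s \<longlonglongrightarrow> l"
  proof (rule metric_LIMSEQ_I)
    fix e :: real assume e: "e > 0"
    obtain M where M: "\<And>i j. i \<ge> M \<Longrightarrow> j \<ge> M \<Longrightarrow> dist (s i) (s j) < e / 2"
      using metric_CauchyD[OF s, of "e / 2"] e by auto
    have "dist (s i) l < e" if i: "i \<ge> M" for i
    proof -
      have "(norm (s i - l))^2 \<le> (e / 2)^2"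
        unfolding norm_l2_square minus_l2.rep_eq l
        using e M[OF i] by (intro infsum_le_finite_sums summ[of "e / 2" M] tail[of _ "e / 2" M]) auto
      then have "norm (s i - l) \<le> e / 2" by (rule power2_le_imp_le) (use e in simp)
      then show ?thesis using e by (simp add: dist_norm)
    qed
    then show "\<exists>M. \<forall>i\<ge>M. dist (s i) l < e" by blast
  qed
  then show "convergent s" by (rule convergentI)
qed

section \<open>Shifts, coordinate vectors and orbits in the sequence space\<close>

lift_definition l2_single :: "int \<Rightarrow> 'a::complex_inner \<Rightarrow> 'a l2" is "\<lambda>k x n. if n = k then x else 0"
  by (rule finite_nonzero_values_imp_summable_on) auto

lift_definition l2_shift :: "'a::complex_inner l2 \<Rightarrow> 'a l2" is "\<lambda>f n. f (n + 1)"
  by (erule square_summable_bound[where h = "\<lambda>n. n + 1" and K = 1]) (auto simp: inj_def)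

lift_definition l2_unshift :: "'a::complex_inner l2 \<Rightarrow> 'a l2" is "\<lambda>f n. f (n - 1)"
  by (erule square_summable_bound[where h = "\<lambda>n. n - 1" and K = 1]) (auto simp: inj_def)

lemma l2_eqI: "(\<And>n. l2_nth f n = l2_nth g n) \<Longrightarrow> f = g"
  by (simp add: l2_nth_inject[symmetric] fun_eq_iff)

lemma l2_nth_scaleC: "l2_nth (c *\<^sub>C f) n = c *\<^sub>C l2_nth f n"
  by (simp add: scaleC_l2.rep_eq)

lemmas l2_nth_simps = plus_l2.rep_eq minus_l2.rep_eq l2_nth_scaleC zero_l2.rep_eq
  l2_single.rep_eq l2_shift.rep_eq l2_unshift.rep_eq

lemma bij_int_shift: "bij (\<lambda>n::int. n + k)"
  by (rule bij_betwI[where g = "\<lambda>n. n - k"]) auto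

lemma l2_shift_add: "l2_shift (f + g) = l2_shift f + l2_shift g"
  by (rule l2_eqI) (simp add: l2_nth_simps)

lemma l2_shift_diff: "l2_shift (f - g) = l2_shift f - l2_shift g"
  by (rule l2_eqI) (simp add: l2_nth_simps)

lemma l2_shift_scaleC: "l2_shift (c *\<^sub>C f) = c *\<^sub>C l2_shift f"
  by (rule l2_eqI) (simp add: l2_nth_simps)

lemma l2_shift_unshift: "l2_shift (l2_unshift f) = f"
  by (rule l2_eqI) (simp add: l2_nth_simps)

lemma l2_nth_shift_funpow: "l2_nth ((l2_shift ^^ k) f) n = l2_nth f (n + int k)"
  by (induction k arbitrary: n) (simp_all add: l2_nth_simps algebra_simps)

lemma cinner_l2_shift: "cinner (l2_shift f) (l2_shift g) = cinner f g"
  unfolding cinner_l2.rep_eq l2_shift.rep_eq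
  using infsum_reindex_bij_betw[OF bij_int_shift, of "\<lambda>n. cinner (l2_nth f n) (l2_nth g n)"] .

lemma cinner_l2_single: "cinner (l2_single k x) f = cinner x (l2_nth f k)"
proof -
  have "cinner (l2_single k x) f = (\<Sum>\<^sub>\<infinity>n\<in>{k}. cinner x (l2_nth f n))"
    unfolding cinner_l2.rep_eq by (rule infsum_cong_neutral) (auto simp: l2_nth_simps)
  then show ?thesis by simp
qed

lemma cinner_l2_single_right: "cinner f (l2_single k x) = cinner (l2_nth f k) x"
  by (metis cinner_commute cinner_l2_single)

text \<open>The bilateral shift to the right combined with \<open>Y\<close> in each coordinate.
  \<open>Abs_l2\<close> is meaningful only on square summable sequences, which a bound on
  \<open>Y\<close> guarantees.\<close>

definition shift_map :: "('a \<Rightarrow> 'a) \<Rightarrow> 'a::complex_inner l2 \<Rightarrow> 'a l2" where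
  "shift_map Y f = Abs_l2 (\<lambda>n. Y (l2_nth f (n - 1)))"

text \<open>For linear \<open>Y\<close> of norm below 1 this is the inverse of
  \<open>1 - shift_map Y\<close> applied to the sequence with sole entry \<open>x\<close> at
  0.\<close>

definition orbit :: "('a \<Rightarrow> 'a) \<Rightarrow> 'a::complex_inner \<Rightarrow> 'a l2" where
  "orbit Y x = Abs_l2 (\<lambda>n. if 0 \<le> n then (Y ^^ nat n) x else 0)"

lemma l2_nth_shift_map:
  assumes bd: "\<And>x. norm (Y x) \<le> q * norm x"
  shows "l2_nth (shift_map Y f) n = Y (l2_nth f (n - 1))"
proof -
  have "(\<lambda>n. (norm (Y (l2_nth f (n - 1))))^2) summable_on UNIV"
    by (rule square_summable_bound[OF l2_summable[of f], where h = "\<lambda>n. n - 1" and K = q]) (auto simp: inj_def bd)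
  then show ?thesis by (simp add: shift_map_def Abs_l2_inverse)
qed

lemma norm_shift_map_le:
  assumes bd: "\<And>x. norm (Y x) \<le> q * norm x" and q: "q \<ge> 0"
  shows "norm (shift_map Y f) \<le> q * norm f"
proof -
  note reindex = infsum_reindex_bij_betw[OF bij_int_shift, of "\<lambda>n. (norm (l2_nth f n))^2" "-1"]
    summable_on_reindex_bij_betw[OF bij_int_shift, of "\<lambda>n. (norm (l2_nth f n))^2" "-1"]
  have "(norm (shift_map Y f))^2 \<le> (\<Sum>\<^sub>\<infinity>n. q^2 * (norm (l2_nth f (n - 1)))^2)"
    unfolding norm_l2_square
  proof (rule infsum_mono)
    show "(\<lambda>n. (norm (l2_nth (shift_map Y f) n))^2) summable_on UNIV" by (rule l2_summable)
    show "(\<lambda>n. q^2 * (norm (l2_nth f (n - 1)))^2) summable_on UNIV"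
      using reindex(2) l2_summable[of f] by (intro summable_on_cmult_right) simp
    show "(norm (l2_nth (shift_map Y f) n))^2 \<le> q^2 * (norm (l2_nth f (n - 1)))^2" for n
      using power_mono[OF bd[of "l2_nth f (n - 1)"], of 2]
      by (simp add: l2_nth_shift_map[OF bd] power_mult_distrib)
  qed
  also have "\<dots> = (q * norm f)^2"
    using reindex(1) by (simp add: infsum_cmult_right' norm_l2_square power_mult_distrib)
  finally show ?thesis by (rule power2_le_imp_le) (use q in simp)
qed

lemma l2_nth_orbit:
  assumes bd: "\<And>x. norm (Y x) \<le> q * norm x" and q: "0 \<le> q" "q < 1"
  shows "l2_nth (orbit Y x) n = (if 0 \<le> n then (Y ^^ nat n) x else 0)"
proof -
  define g where "g n = (if 0 \<le> n then (Y ^^ nat n) x else 0)" for n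
  have pow: "norm ((Y ^^ n) x) \<le> q ^ n * norm x" for n
  proof (induction n)
    case (Suc n)
    have "norm ((Y ^^ Suc n) x) \<le> q * norm ((Y ^^ n) x)" using bd by simp
    also have "\<dots> \<le> q * (q ^ n * norm x)" by (intro mult_left_mono Suc q)
    finally show ?case by simp
  qed simp
  \<comment> \<open>A geometric majorant for the nonnegative coordinates; the negative ones
    vanish.\<close>
  have "summable (\<lambda>n. (q^2) ^ n * (norm x)^2)"
    using q by (intro summable_mult2 summable_geometric) (simp add: power_less_one_iff)
  then have "summable (\<lambda>n. (norm (g (int n)))^2)"
  proof (rule summable_comparison_test', simp)
    fix n
    have "(norm ((Y ^^ n) x))^2 \<le> (q ^ n * norm x)^2" by (intro power_mono pow) simp
    also have "\<dots> = (q^2) ^ n * (norm x)^2" by (simp add: power_mult_distrib power_commutes flip: power_mult)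
      (simp add: mult.commute)
    finally show "(norm (g (int n)))^2 \<le> (q^2) ^ n * (norm x)^2" by (simp add: g_def)
  qed
  then have "(\<lambda>n. (norm (g (int n)))^2) summable_on UNIV"
    by (intro norm_summable_imp_summable_on) simp
  then have "(\<lambda>n. (norm (g n))^2) summable_on range int"
    using summable_on_reindex[of int UNIV "\<lambda>n. (norm (g n))^2"] by (simp add: o_def)
  then have "(\<lambda>n. (norm (g n))^2) summable_on UNIV"
  proof (rule summable_on_cong_neutral[THEN iffD1, rotated -1])
    fix n :: int assume "n \<in> UNIV - range int"
    then have "n < 0" by (metis DiffD2 int_nat_eq linorder_not_le rangeI)
    then show "(norm (g n))^2 = 0" by (simp add: g_def)
  qed auto
  then show ?thesis by (simp add: orbit_def Abs_l2_inverse g_def)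
qed

text \<open>The bounds make the norm of \<open>b\<close> equivalent to the given one: the lower
  bound gives definiteness and carries Cauchy sequences over, the upper bound carries limits
  back.\<close>

lemma hilbert_of_form:
  fixes b :: "'a::complex_hilbert_space \<Rightarrow> 'a \<Rightarrow> complex"
  assumes commute: "\<And>x y. b x y = cnj (b y x)" and add: "\<And>x y z. b (x + y) z = b x z + b y z"
    and scale: "\<And>c x y. b (c *\<^sub>C x) y = c * b x y"
    and lower: "\<And>x. m * (norm x)^2 \<le> Re (b x x)" and upper: "\<And>x. Re (b x x) \<le> M * (norm x)^2"
    and m: "m > 0"
  shows "hilbert \<lparr>pts = UNIV, vadd = (+), vzero = 0, vscale = (*\<^sub>C), vip = b\<rparr>" (is "hilbert ?K")
proof -
  have dist: "vdist ?K x y = sqrt (Re (b (x - y) (x - y)))" for x y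
    using scaleC_of_real[of "-1" y] by (simp add: vdist_def Let_def)
  have nonneg: "0 \<le> Re (b x x)" for x
    using lower[of x] m by (meson mult_nonneg_nonneg order_trans less_imp_le zero_le_power2)
  have zero: "x = 0" if "b x x = 0" for x
    using lower[of x] m that by (auto simp: mult_le_0_iff)
  have minus: "(-1) *\<^sub>C x = - x" for x :: 'a using scaleC_of_real[of "-1" x] by simp
  show ?thesis
  proof (rule hilbert.intro, goal_cases)
    case (17 s)
    have "Cauchy s"
    proof (rule metric_CauchyI)
      fix e :: real assume e: "e > 0"
      then have "sqrt m * e > 0" using m by simp
      then obtain N where N: "\<And>i j. i \<ge> N \<Longrightarrow> j \<ge> N \<Longrightarrow> vdist ?K (s i) (s j) < sqrt m * e"
        using 17(2) by blast
      have "dist (s i) (s j) < e" if "i \<ge> N" "j \<ge> N" for i j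
      proof -
        have "sqrt m * norm (s i - s j) \<le> vdist ?K (s i) (s j)"
          using real_sqrt_le_mono[OF lower[of "s i - s j"]] by (simp add: dist real_sqrt_mult)
        with N[OF that] have "sqrt m * norm (s i - s j) < sqrt m * e" by simp
        then show ?thesis using m by (simp add: dist_norm)
      qed
      then show "\<exists>N. \<forall>i\<ge>N. \<forall>j\<ge>N. dist (s i) (s j) < e" by blast
    qed
    then obtain l where l: "s \<longlonglongrightarrow> l" by (auto simp: Cauchy_convergent_iff convergent_def)
    have "(\<lambda>n. vdist ?K (s n) l) \<longlonglongrightarrow> 0"
    proof (rule tendsto_sandwich[OF _ _ tendsto_const])
      have "(\<lambda>n. sqrt (M * (norm (s n - l))^2)) \<longlonglongrightarrow> sqrt (M * 0^2)"
        using l by (intro tendsto_intros tendsto_norm_zero) (simp add: LIM_zero_iff)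
      then show "(\<lambda>n. sqrt (M * (norm (s n - l))^2)) \<longlonglongrightarrow> 0" by simp
    qed (auto simp: dist nonneg upper)
    then show ?case by auto
  qed (auto simp: scaleC_add_right scaleC_add_left scaleC_scaleC scaleC_one add scale nonneg
      add_ac minus intro: commute zero)
qed

lemma bounded_clinear_funpow:
  fixes Y :: "'a::complex_inner \<Rightarrow> 'a"
  assumes Y: "bounded_clinear Y"
  shows "bounded_clinear (Y ^^ n)"
proof (induction n)
  case 0
  show ?case by (rule bounded_clinearI[where K = 1]) auto
next
  case (Suc n)
  then show ?case using bounded_clinear_compose[OF Y] by (simp only: funpow.simps)
qed

text \<open>With \<open>Z = shift_map X\<close>, the unitary bilateral shift dilates \<open>X\<close> on the sequence space with the form
  \<open>b (f, g) = \<langle>f + W f / \<rho>, g\<rangle> + \<langle>f, W g / \<rho>\<rangle>\<close>, \<open>W = \<Sum>\<^sub>n\<^sub>\<ge>\<^sub>1 Z\<^sup>n\<close>, transported along \<open>1 - Z\<close>, which turns \<open>W\<close> into \<open>Z\<close>.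
  For small \<open>X\<close> the form is equivalent to the inner product.\<close>

lemma rho_contraction_small:
  fixes X :: "'a::complex_hilbert_space \<Rightarrow> 'a"
  assumes X: "bounded_clinear X" and bd: "\<And>x. norm (X x) \<le> \<rho> / 16 * norm x"
    and \<rho>: "0 < \<rho>" "\<rho> \<le> 2"
  shows "rho_contraction \<rho> X"
proof -
  \<comment> \<open>Then \<open>q \<le> 1/8\<close> and \<open>2 / \<rho> * q = 1/8\<close>, the two
    constants behind \<open>b_bounds\<close>.\<close>
  define q where "q = \<rho> / 16"
  have q: "0 \<le> q" "q \<le> 1/8" "q < 1" using \<rho> by (auto simp: q_def)
  define Z where "Z = shift_map X"
  define D where "D f = f - Z f" for f
  define V where "V = orbit X"
  define b where "b f g = cinner (D f) (D g) + of_real (1 / \<rho>) * (cinner (Z f) (D g) + cinner (D f) (Z g))" for f g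
  have bd': "norm (X x) \<le> q * norm x" for x using bd by (simp add: q_def)
  have Z_nth: "l2_nth (Z f) n = X (l2_nth f (n - 1))" for f n
    unfolding Z_def by (rule l2_nth_shift_map) (rule bd')
  have Z_norm: "norm (Z f) \<le> q * norm f" for f
    unfolding Z_def by (rule norm_shift_map_le) (use bd' q in auto)
  have V_nth: "l2_nth (V x) n = (if 0 \<le> n then (X ^^ nat n) x else 0)" for x n
    unfolding V_def by (rule l2_nth_orbit[of _ q]) (use bd' q in auto)
  note Xpow = bounded_clinear_funpow[OF X]
  have Z_add: "Z (f + g) = Z f + Z g" for f g
    by (rule l2_eqI) (simp add: Z_nth l2_nth_simps bounded_clinear_add[OF X])
  have Z_scale: "Z (c *\<^sub>C f) = c *\<^sub>C Z f" for c f
    by (rule l2_eqI) (simp add: Z_nth l2_nth_simps bounded_clinear_scaleC[OF X])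
  have Z_shift: "Z (l2_shift f) = l2_shift (Z f)" for f
    by (rule l2_eqI) (simp add: Z_nth l2_nth_simps)
  have D_add: "D (f + g) = D f + D g" for f g by (simp add: D_def Z_add)
  have D_scale: "D (c *\<^sub>C f) = c *\<^sub>C D f" for c f by (simp add: D_def Z_scale scaleC_diff_right)
  have D_shift: "D (l2_shift f) = l2_shift (D f)" for f by (simp add: D_def Z_shift l2_shift_diff)
  have V_add: "V (x + y) = V x + V y" for x y
    by (rule l2_eqI) (simp add: V_nth l2_nth_simps bounded_clinear_add[OF Xpow])
  have V_scale: "V (c *\<^sub>C x) = c *\<^sub>C V x" for c x
    by (rule l2_eqI) (simp add: V_nth l2_nth_simps bounded_clinear_scaleC[OF Xpow] scaleC_zero)
  \<comment> \<open>\<open>Z\<close> moves the orbit one place to the right, so only the initial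
    entry survives in the difference.\<close>
  have DV: "D (V x) = l2_single 0 x" for x
  proof (rule l2_eqI)
    fix n :: int
    consider "n < 0" | "n = 0" | m where "n = int (Suc m)"
      by (metis nat_0_le not0_implies_Suc not_le of_nat_0)
    then show "l2_nth (D (V x)) n = l2_nth (l2_single 0 x) n"
    proof cases
      case (3 m)
      then have "nat n = Suc m" "nat (n - 1) = m" "n - 1 \<ge> 0" by auto
      then show ?thesis using 3 by (simp add: D_def l2_nth_simps Z_nth V_nth del: of_nat_Suc)
    qed (simp_all add: D_def l2_nth_simps Z_nth V_nth bounded_clinear_zero[OF X])
  qed
  have Z_eq: "Z f = f - D f" for f by (simp add: D_def)

  have b_commute: "b f g = cnj (b g f)" for f g
    unfolding b_def by (simp flip: cinner_commute)
  have b_add: "b (f + g) k = b f k + b g k" for f g k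
    unfolding b_def by (simp add: D_add Z_add cinner_simps algebra_simps)
  have b_scale: "b (c *\<^sub>C f) g = c * b f g" for c f g
    unfolding b_def by (simp add: D_scale Z_scale cinner_simps algebra_simps)
  \<comment> \<open>The cross term is at most \<open>N * d / 8\<close>, and \<open>d\<close> lies
    between 7/8 and 9/8 of \<open>N\<close>; the resulting factors 42/64 and 90/64 lie between 1/2
    and 2.\<close>
  have b_bounds: "1/2 * (norm f)^2 \<le> Re (b f f)" "Re (b f f) \<le> 2 * (norm f)^2" for f
  proof -
    define N d r where "N = norm f" and "d = norm (D f)" and "r = Re (cinner (Z f) (D f))"
    have "q * N \<le> N / 8" using mult_right_mono[OF q(2), of N] by (simp add: N_def)
    then have ZN: "norm (Z f) \<le> N / 8" using Z_norm[of f] by (simp add: N_def)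
    have d: "7/8 * N \<le> d" "d \<le> 9/8 * N"
      using norm_triangle_ineq2[of f "Z f"] norm_triangle_ineq4[of f "Z f"] ZN
      by (simp_all add: N_def d_def D_def)
    have N0: "0 \<le> N" and d0: "0 \<le> d" by (simp_all add: N_def d_def)
    have "\<bar>r\<bar> \<le> norm (Z f) * d"
      unfolding r_def d_def using abs_Re_le_cmod cinner_Cauchy_Schwarz by (rule order_trans)
    also have "\<dots> \<le> (q * N) * d"
      using Z_norm[of f] d0 by (intro mult_right_mono) (simp_all add: N_def)
    finally have "\<bar>2 / \<rho> * r\<bar> \<le> 2 / \<rho> * ((q * N) * d)"
      using \<rho> by (simp add: abs_mult divide_right_mono)
    also have "\<dots> = N * d / 8" using \<rho> by (simp add: q_def)
    finally have r: "\<bar>2 / \<rho> * r\<bar> \<le> N * d / 8" .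
    have "Re (cinner (D f) (Z f)) = r"
      unfolding r_def by (subst cinner_commute) simp
    then have bff: "Re (b f f) = d^2 + 2 / \<rho> * r"
      by (simp add: b_def r_def d_def cinner_self flip: of_real_power of_real_divide)
    have "1/2 * N^2 \<le> (7/8 * N) * (6/8 * N)" using N0 by (simp add: power2_eq_square)
    also have "\<dots> \<le> d * (d - N / 8)" using d N0 d0 by (intro mult_mono) auto
    also have "\<dots> = d^2 - N * d / 8" by (simp add: power2_eq_square algebra_simps)
    finally show "1/2 * (norm f)^2 \<le> Re (b f f)" using r bff unfolding N_def by linarith
    have "d^2 + N * d / 8 = d * (d + N / 8)" by (simp add: power2_eq_square algebra_simps)
    also have "\<dots> \<le> (9/8 * N) * (10/8 * N)" using d N0 d0 by (intro mult_mono) auto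
    also have "\<dots> \<le> 2 * N^2" using N0 by (simp add: power2_eq_square)
    finally show "Re (b f f) \<le> 2 * (norm f)^2" using r bff unfolding N_def by linarith
  qed
  define K where "K = \<lparr>pts = UNIV, vadd = (+), vzero = 0, vscale = (*\<^sub>C), vip = b\<rparr>"
  interpret hilbert K
    unfolding K_def by (rule hilbert_of_form[OF b_commute b_add b_scale b_bounds]) simp

  have D_pow: "D ((l2_shift ^^ n) f) = (l2_shift ^^ n) (D f)" for n f
    by (induction n) (simp_all add: D_shift)
  \<comment> \<open>Shifting moves the entry of \<open>D (V y)\<close> from 0 to \<open>- n\<close>,
    and orbits vanish at negative places, so for \<open>n \<ge> 1\<close> only
    \<open>cinner (Z g) (D (V x))\<close> survives. It reads off the entry \<open>(X ^^ n) y\<close>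
    of \<open>g\<close> at 0, which for \<open>n = 0\<close> is cancelled by that of
    \<open>D g\<close>.\<close>
  have b_pow: "b ((l2_shift ^^ n) (V y)) (V x) =
      (if n = 0 then cinner y x else of_real (1 / \<rho>) * cinner ((X ^^ n) y) x)" for n x y
  proof -
    define g where "g = (l2_shift ^^ n) (V y)"
    have Dg: "D g = l2_single (- int n) y"
      unfolding g_def D_pow DV by (rule l2_eqI) (auto simp: l2_nth_shift_funpow l2_nth_simps)
    have "cinner (Z g) (D (V x)) = (if n = 0 then 0 else cinner ((X ^^ n) y) x)"
      unfolding Z_eq[of g] DV cinner_l2_single_right Dg
      by (simp add: g_def l2_nth_simps l2_nth_shift_funpow V_nth)
    moreover have "cinner (D g) (Z (V x)) = 0"
      unfolding Z_eq[of "V x"] DV Dg cinner_l2_single by (simp add: l2_nth_simps V_nth)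
    moreover have "cinner (D g) (D (V x)) = (if n = 0 then cinner y x else 0)"
      unfolding DV Dg cinner_l2_single_right by (simp add: l2_nth_simps)
    ultimately show ?thesis unfolding b_def g_def[symmetric] by simp
  qed
  have bV: "b (V y) (V x) = cinner y x" for x y using b_pow[of 0 y x] by simp
  \<comment> \<open>The vectors \<open>h\<close> define the adjoint \<open>H\<close> of
    \<open>V\<close> for the form \<open>b\<close>; as \<open>V\<close> is isometric,
    \<open>V\<close> after \<open>H\<close> is the orthogonal projection onto its range.\<close>
  have "\<exists>h. \<forall>x. b (V x) g = cinner x h" for g
  proof -
    have "cmod (b (V x) g) \<le> sqrt (Re (b g g)) * norm x" for x
      using Cauchy_Schwarz[of "V x" g]
      by (simp add: K_def bV cinner_self mult.commute flip: of_real_power)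
    then show ?thesis
      using Riesz[of "\<lambda>x. b (V x) g" "sqrt (Re (b g g))"] by (metis V_add V_scale b_add b_scale)
  qed
  then obtain H where H: "\<And>x g. b (V x) g = cinner x (H g)" by metis
  have minus: "(-1) *\<^sub>C f = - f" for f :: "'a l2" using scaleC_of_real[of "-1" f] by simp
  have "rho_dilation \<rho> X K V l2_shift"
    unfolding rho_dilation_def
  proof (intro conjI exI[of _ "\<lambda>g. V (H g)"] allI impI)
    show "hilbert K" by (rule hilbert_axioms)
    show "isometric_embedding K V"
      by (simp add: isometric_embedding_def K_def V_add V_scale bV)
    have "b (l2_shift f) (l2_shift g) = b f g" for f g
      by (simp add: b_def Z_shift D_shift cinner_l2_shift)
    moreover have "surj l2_shift" by (rule surjI) (rule l2_shift_unshift)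
    ultimately show "unitary_on K l2_shift"
      by (simp add: unitary_on_def K_def l2_shift_add l2_shift_scaleC)
    have "b (g - V (H g)) (V x) = 0" for g x
    proof -
      have "b g (V x) = cinner (H g) x" by (subst b_commute) (simp add: H flip: cinner_commute)
      moreover have "b (- V (H g)) (V x) = - cinner (H g) x"
        using b_scale[of "-1" "V (H g)" "V x"] by (simp add: bV minus)
      ultimately show ?thesis using b_add[of g "- V (H g)" "V x"] by simp
    qed
    then show "orth_projection K (range V) (\<lambda>g. V (H g))"
      by (auto simp: orth_projection_def K_def minus)
    show "V ((X ^^ n) x) = vscale K (complex_of_real \<rho>) (V (H ((l2_shift ^^ n) (V x))))"
      if n: "1 \<le> n" for n x
    proof -
      have "(X ^^ n) x = complex_of_real \<rho> *\<^sub>C H ((l2_shift ^^ n) (V x))"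
      proof (rule cinner_ext)
        fix y
        have "cinner y (H ((l2_shift ^^ n) (V x))) = cnj (of_real (1 / \<rho>) * cinner ((X ^^ n) x) y)"
          unfolding H[symmetric] using n by (subst b_commute) (simp add: b_pow)
        also have "\<dots> = of_real (1 / \<rho>) * cinner y ((X ^^ n) x)"
          by (simp flip: cinner_commute)
        finally show "cinner y ((X ^^ n) x) = cinner y (complex_of_real \<rho> *\<^sub>C H ((l2_shift ^^ n) (V x)))"
          using \<rho> by (simp add: cinner_simps)
      qed
      then show ?thesis by (simp add: K_def V_scale)
    qed
  qed
  with X show ?thesis by (rule rho_contractionI)
qed

text \<open>Makes the set in \<open>rho_radius\<close> nonempty, so that lower bounds of its members
  pass to the infimum.\<close>

lemma rho_contraction_scaling_exists:
  fixes X :: "'a::complex_hilbert_space \<Rightarrow> 'a"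
  assumes X: "bounded_clinear X" and \<rho>: "0 < \<rho>" "\<rho> \<le> 2"
  shows "\<exists>t>0. rho_contraction \<rho> (\<lambda>x. inverse t *\<^sub>R X x)"
proof -
  \<comment> \<open>Large enough to bring the norm down to \<rho> / 16; the added 1 keeps
    \<open>t\<close> positive for \<open>X = 0\<close>.\<close>
  define t where "t = 16 * (onorm X + 1) / \<rho>"
  have X0: "onorm X \<ge> 0" using X by (simp add: bounded_clinear_def onorm_pos_le)
  then have t: "t > 0" using \<rho> by (simp add: t_def)
  have "rho_contraction \<rho> (\<lambda>x. inverse t *\<^sub>R X x)"
  proof (rule rho_contraction_small[OF _ _ \<rho>])
    show "bounded_clinear (\<lambda>x. inverse t *\<^sub>R X x)" by (rule bounded_clinear_scaleR_op[OF X])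
    show "norm (inverse t *\<^sub>R X x) \<le> \<rho> / 16 * norm x" for x
    proof -
      have "norm (X x) \<le> (onorm X + 1) * norm x"
        using bounded_clinear_onorm[OF X, of x] by (simp add: distrib_right add_increasing2)
      also have "\<dots> = \<rho> / 16 * norm x * t" using \<rho> by (simp add: t_def)
      finally have "norm (X x) / t \<le> \<rho> / 16 * norm x" unfolding pos_divide_le_eq[OF t] .
      then show ?thesis using t by (simp add: inverse_eq_divide)
    qed
  qed
  with t show ?thesis by blast
qed

section \<open>The \<open>\<rho>\<close>-radius and the main inequality\<close>

lemma rho_radius_nonneg:
  fixes X :: "'a::complex_hilbert_space \<Rightarrow> 'a"
  assumes "bounded_clinear X" "0 < \<rho>" "\<rho> \<le> 2"
  shows "0 \<le> rho_radius \<rho> X"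
  unfolding rho_radius_def using rho_contraction_scaling_exists[OF assms]
  by (intro cInf_greatest) auto

text \<open>Every admissible \<open>t\<close> bounds the left-hand side, by homogeneity; hence so
  does the infimum.\<close>

lemma rho_radius_numerical_range:
  fixes X :: "'a::complex_hilbert_space \<Rightarrow> 'a"
  assumes X: "bounded_clinear X" and \<rho>: "0 < \<rho>" "\<rho> \<le> 2" and z: "(norm x)^2 + (norm y)^2 = 1"
  shows "cmod (sqrt (8 * inverse \<rho> - 4) * cinner (X y) x + complex_of_real (2 * inverse \<rho> - 2) * cinner (X y) y)
    \<le> rho_radius \<rho> X"
  unfolding rho_radius_def
  using rho_contraction_scaling_exists[OF X \<rho>] rho_contraction_scaled_numerical_range[OF _ \<rho>, of _ X y x]
  by (intro cInf_greatest) (auto simp: z)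

text \<open>The vector \<open>v\<close> arises from \<open>a\<close> by an operator that is
  \<open>\<mu> - 1\<close> along \<open>e\<close> and -1 on the orthogonal complement, so its norm
  grows by at most the maximum. The value \<mu> = 2 gives the classical inequality.\<close>

lemma Buzano:
  fixes a b e :: "'a::complex_inner" and \<mu> :: complex
  assumes e: "norm e = 1" and \<mu>: "\<mu> \<noteq> 0"
  shows "cmod (cinner a e) * cmod (cinner e b)
    \<le> (cmod (cinner a b) + max 1 (cmod (\<mu> - 1)) * (norm a * norm b)) / cmod \<mu>"
proof -
  define k where "k = cinner a e"
  define m where "m = max 1 (cmod (\<mu> - 1))"
  define v where "v = (\<mu> * k) *\<^sub>C e - a"
  have ea: "cinner e a = cnj k" unfolding k_def by (rule cinner_commute)
  have ee: "cinner e e = 1" by (simp add: cinner_self e)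
  have k: "(cmod k)^2 \<le> (norm a)^2"
    using power_mono[OF cinner_Cauchy_Schwarz[of a e], of 2] by (simp add: k_def e)
  have "cinner v v = \<mu> * k * cnj (\<mu> * k) - \<mu> * k * cnj k - cnj \<mu> * cnj k * k + (norm a)^2"
    unfolding v_def by (simp only: cinner_simps ee ea cinner_self[of a] k_def[symmetric])
      (simp add: algebra_simps)
  also have "\<dots> = of_real (((cmod (\<mu> - 1))^2 - 1) * (cmod k)^2 + (norm a)^2)"
    unfolding of_real_add of_real_mult of_real_diff complex_norm_square by (simp add: algebra_simps)
  finally have "(norm v)^2 = ((cmod (\<mu> - 1))^2 - 1) * (cmod k)^2 + (norm a)^2"
    by (simp only: cinner_self of_real_eq_iff)
  also have "\<dots> \<le> (m^2 - 1) * (cmod k)^2 + (norm a)^2"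
    unfolding m_def by (intro add_right_mono mult_right_mono diff_right_mono power_mono) auto
  also have "\<dots> \<le> (m^2 - 1) * (norm a)^2 + (norm a)^2"
    using k by (intro add_right_mono mult_left_mono) (auto simp: m_def)
  also have "\<dots> = (m * norm a)^2" by (simp add: power_mult_distrib algebra_simps)
  finally have v: "norm v \<le> m * norm a" by (rule power2_le_imp_le) (simp add: m_def)
  have "\<mu> * (cinner a e * cinner e b) = cinner a b + cinner v b"
    by (simp add: v_def k_def cinner_simps mult.assoc)
  then have "cmod \<mu> * (cmod (cinner a e) * cmod (cinner e b)) \<le> cmod (cinner a b) + cmod (cinner v b)"
    by (metis norm_mult norm_triangle_ineq)
  also have "cmod (cinner v b) \<le> m * (norm a * norm b)"
    using cinner_Cauchy_Schwarz[of v b] mult_right_mono[OF v norm_ge_zero[of b]] by simp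
  finally show ?thesis using \<mu> by (simp add: m_def pos_le_divide_eq mult.commute)
qed

theorem theorem2p12:
  fixes X :: "'a::complex_hilbert_space \<Rightarrow> 'a"
    and \<rho> \<nu> \<alpha> \<beta> :: real and \<mu> :: complex
    and A B C :: "'a \<Rightarrow> 'a"
  assumes "0 < \<rho>" and "\<rho> \<le> 2" and "0 \<le> \<nu>" and "\<nu> \<le> 1"
    and "\<alpha> = sqrt (8 * inverse \<rho> - 4)" and "\<beta> = 2 * inverse \<rho> - 2"
    and "bounded_clinear X" and "\<mu> \<noteq> 0"
    and "A = (\<lambda>x. \<alpha>^2 *\<^sub>R (abs_op (cadjoint X) ^^ 2) x)"
    and "B = (\<lambda>x. (\<alpha> * \<beta>) *\<^sub>R (abs_op (cadjoint X) ^^ 2) x)"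
    and "C = (\<lambda>x. (\<alpha>^2 + \<beta>^2) *\<^sub>R (abs_op X ^^ 2) x + \<beta>^2 *\<^sub>R (abs_op (cadjoint X) ^^ 2) x)"
  shows "(Delta \<rho> \<nu> X)^2 \<le>
      (1 - 2 * \<nu>)^2 * (rho_radius \<rho> X)^2
      + 2 * cmod (complex_of_real ((1 - 2 * \<nu>) * \<beta>) / \<mu>) * rho_radius \<rho> (X ^^ 2)
      + (2 * \<bar>1 - 2 * \<nu>\<bar> * max 1 (cmod (\<mu> - 1)) + cmod \<mu>) / (2 * cmod \<mu>)
          * onorm (op_matrix A B B C)"
proof -
  note \<rho> = assms(1,2) and \<alpha> = assms(5) and \<beta> = assms(6) and X = assms(7) and \<mu> = assms(8)
  define c where "c = 1 - 2 * \<nu>"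
  define X' where "X' = cadjoint X"
  define w where "w = rho_radius \<rho> X"
  define w2 where "w2 = rho_radius \<rho> (X ^^ 2)"
  define N where "N = op_matrix A B B C"
  define n where "n = onorm N"
  define m where "m = max 1 (cmod (\<mu> - 1))"
  define R where "R = c^2 * w^2 + 2 * cmod (complex_of_real (c * \<beta>) / \<mu>) * w2
    + (2 * \<bar>c\<bar> * m + cmod \<mu>) / (2 * cmod \<mu>) * n"
  have X': "bounded_clinear X'" unfolding X'_def by (rule bounded_clinear_cadjoint[OF X])
  have XX: "bounded_clinear (X ^^ 2)" by (rule bounded_clinear_funpow[OF X])
  have adj: "cinner (X x) y = cinner x (X' y)" for x y
    unfolding X'_def by (rule cinner_cadjoint[OF X])
  have adj': "cinner (X' x) y = cinner x (X y)" for x y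
    using arg_cong[OF adj[of y x], of cnj] by (simp flip: cinner_commute)
  have w: "0 \<le> w" and w2: "0 \<le> w2"
    using rho_radius_nonneg[OF X \<rho>] rho_radius_nonneg[OF XX \<rho>] by (simp_all add: w_def w2_def)

  \<comment> \<open>\<open>abs_op\<close> occurs only squared, so the entries become products of
    \<open>X\<close> and its adjoint.\<close>
  have A: "A x = \<alpha>^2 *\<^sub>R X (X' x)" and B: "B x = (\<alpha> * \<beta>) *\<^sub>R X (X' x)"
    and C: "C x = (\<alpha>^2 + \<beta>^2) *\<^sub>R X' (X x) + \<beta>^2 *\<^sub>R X (X' x)" for x
    by (simp_all add: assms(9-11) abs_op_square[OF X] abs_op_square[OF X'[unfolded X'_def]]
        cadjoint_cadjoint[OF X] X'_def)
  have "bounded_linear N"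
  proof -
    have lin: "bounded_linear (\<lambda>z. X (X' (fst z)))" "bounded_linear (\<lambda>z. X (X' (snd z)))"
      "bounded_linear (\<lambda>z. X' (X (snd z)))"
      using X X' unfolding bounded_clinear_def
      by (auto intro!: bounded_linear_compose[of X] bounded_linear_compose[of X']
          bounded_linear_fst bounded_linear_snd)
    have "N = (\<lambda>z. (A (fst z) + B (snd z), B (fst z) + C (snd z)))"
      by (simp add: N_def op_matrix_def fun_eq_iff)
    then show ?thesis
      unfolding A B C
      by (simp only:) (intro bounded_linear_Pair bounded_linear_add bounded_linear_const_scaleR lin)
  qed
  note N_bd = onorm[OF this] and n = onorm_pos_le[OF this]

  have R: "0 \<le> R"
    unfolding R_def using w2 n
    by (intro add_nonneg_nonneg mult_nonneg_nonneg divide_nonneg_nonneg) (auto simp: m_def n_def)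

  define M where "M = op_matrix (\<lambda>x. 0) (\<lambda>x. \<alpha> *\<^sub>R X x) (\<lambda>x. (\<alpha> * c) *\<^sub>R X' x)
    (\<lambda>x. \<beta> *\<^sub>R (X x + c *\<^sub>R X' x))"
  have M_bd: "cmod (cinner (M z) z) \<le> sqrt R" if z: "norm z = 1" for z
  proof -
    obtain x y where xy: "z = (x, y)" by fastforce
    have z2: "(norm x)^2 + (norm y)^2 = 1" using z by (simp add: xy norm_Pair)
    \<comment> \<open>\<open>T\<close> and \<open>T'\<close> are the images of \<open>z\<close>
      under the operator \<open>[[0, \<alpha> X], [0, \<beta> X]]\<close> and under its
      adjoint.\<close>
    define T where "T = (\<alpha> *\<^sub>R X y, \<beta> *\<^sub>R X y)"
    define T' where "T' = (0::'a, \<alpha> *\<^sub>R X' x + \<beta> *\<^sub>R X' y)"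
    define s where "s = cinner T z"
    have sT': "cinner z T' = s"
      by (simp add: s_def T_def T'_def xy cinner_prod_def cinner_simps adj)
    have s_eq: "s = \<alpha> * cinner (X y) x + \<beta> * cinner (X y) y"
      by (simp add: s_def T_def xy cinner_prod_def cinner_simps)
    have sw: "cmod s \<le> w"
      using rho_radius_numerical_range[OF X \<rho> z2] by (simp add: s_eq w_def \<alpha> \<beta>)
    have "cinner (X' x) y = cnj (cinner (X y) x)" "cinner (X' y) y = cnj (cinner (X y) y)"
      by (simp_all add: adj' flip: cinner_commute)
    then have Ms: "cinner (M z) z = s + c * cnj s"
      by (simp add: M_def op_matrix_def xy cinner_prod_def cinner_simps s_eq algebra_simps)

    \<comment> \<open>This is the form of the squared operator at \<open>z\<close>; it is \<beta>
      times the expression belonging to \<open>X ^^ 2\<close>.\<close>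
    have "cinner T T' = \<beta> * (\<alpha> * cinner ((X ^^ 2) y) x + \<beta> * cinner ((X ^^ 2) y) y)"
      by (simp add: T_def T'_def cinner_prod_def cinner_simps numeral_2_eq_2
          bounded_clinear_scaleR[OF X] algebra_simps flip: adj)
    then have TT': "cmod (cinner T T') \<le> \<bar>\<beta>\<bar> * w2"
      using mult_left_mono[OF rho_radius_numerical_range[OF XX \<rho> z2], of "\<bar>\<beta>\<bar>"]
      by (simp only: norm_mult norm_of_real \<alpha> \<beta> w2_def abs_ge_zero)
    \<comment> \<open>\<open>N\<close> is the sum of the two products of that operator with its
      adjoint.\<close>
    have "(norm T)^2 + (norm T')^2 = inner (N z) z"
    proof -
      have "complex_of_real ((norm T)^2 + (norm T')^2) = cinner (N z) z"
        unfolding of_real_add cinner_self[symmetric]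
        by (simp add: T_def T'_def N_def op_matrix_def xy A B C cinner_prod_def cinner_simps adj adj'
            power2_eq_square algebra_simps)
      then show ?thesis by (metis Re_complex_of_real inner_eq_Re_cinner)
    qed
    also have "\<dots> \<le> n"
      using norm_cauchy_schwarz[of "N z" z] N_bd[of z] z by (simp add: n_def)
    finally have nT: "norm T * norm T' \<le> n / 2"
      using sum_squares_bound[of "norm T" "norm T'"] by simp

    have "cmod s \<le> norm T" "cmod s \<le> norm T'"
      using cinner_Cauchy_Schwarz[of T z] cinner_Cauchy_Schwarz[of z T'] z
      by (simp_all add: sT' flip: s_def)
    then have "cmod s * cmod s \<le> norm T * norm T'" by (intro mult_mono) auto
    then have s2: "(cmod s)^2 \<le> n / 2" using nT by (simp add: power2_eq_square)
    have "(cmod s)^2 = cmod (cinner T z) * cmod (cinner z T')"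
      by (simp add: sT' power2_eq_square flip: s_def)
    also have "\<dots> \<le> (cmod (cinner T T') + m * (norm T * norm T')) / cmod \<mu>"
      unfolding m_def by (rule Buzano[OF z \<mu>])
    also have "\<dots> \<le> (\<bar>\<beta>\<bar> * w2 + m * (n / 2)) / cmod \<mu>"
      using TT' nT by (intro divide_right_mono add_mono mult_left_mono) (auto simp: m_def)
    finally have buz: "(cmod s)^2 \<le> (\<bar>\<beta>\<bar> * w2 + m * (n / 2)) / cmod \<mu>" .

    have "cmod (cinner (M z) z) \<le> cmod s + \<bar>c\<bar> * cmod s"
      unfolding Ms using norm_triangle_ineq[of s "c * cnj s"] by (simp add: norm_mult)
    then have "(cmod (cinner (M z) z))^2 \<le> (cmod s + \<bar>c\<bar> * cmod s)^2" by (rule power_mono) simp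
    \<comment> \<open>The three summands are bounded separately: by the radius of \<open>X\<close>,
      by Buzano, and by \<open>norm T * norm T'\<close>.\<close>
    also have "\<dots> = c^2 * (cmod s)^2 + 2 * \<bar>c\<bar> * (cmod s)^2 + (cmod s)^2"
      by (simp add: power2_eq_square algebra_simps flip: abs_mult)
    also have "\<dots> \<le> c^2 * w^2 + 2 * \<bar>c\<bar> * ((\<bar>\<beta>\<bar> * w2 + m * (n / 2)) / cmod \<mu>) + n / 2"
      using sw by (intro add_mono mult_left_mono buz s2 power_mono) auto
    also have "\<dots> = R"
      using \<mu> by (simp add: R_def norm_divide norm_mult abs_mult field_simps)
    finally show ?thesis by (rule real_le_rsqrt)
  qed
  define S where "S = insert 0 {cmod (cinner (M z) z) | z. norm z = 1}"
  have S: "s \<le> sqrt R" if "s \<in> S" for s using that M_bd R by (auto simp: S_def)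
  have Delta: "Delta \<rho> \<nu> X = Sup S"
    by (simp add: Delta_def numerical_radius_def S_def M_def X'_def c_def \<alpha> \<beta> Let_def)
  \<comment> \<open>The inserted 0 gives the nonnegativity needed for squaring, also on the zero
    space.\<close>
  have "0 \<le> Sup S" using S by (intro cSup_upper) (auto simp: S_def bdd_above_def)
  moreover have "Sup S \<le> sqrt R" using S by (intro cSup_least) (auto simp: S_def)
  ultimately have "(Sup S)^2 \<le> (sqrt R)^2" by (intro power_mono)
  then show ?thesis
    using R by (simp add: Delta R_def c_def w_def w2_def m_def n_def N_def)
qed

end
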